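(* Let $g$ be a bounded real function of $t\ge0$, let $s\ge2$ and $u_0\in E^s_{2,2}$. Assume that there exists a point $x_0\in\mathbb{R}$ such that $u_{0x}(x_0)<0$. Then the corresponding solution $u$ of the Cauchy problem $$u_t+uu_x=\int_{-\infty}^{x}\tfrac12u_x^2(t,z)\,dz+g(t),\qquad u(0,x)=u_0(x),\quad x\in\mathbb{R},$$ blows up in finite time.
   Context: All functions are real-valued on $\mathbb{R}$. For $s\ge2$, $E^s_{2,2}=L^\infty(\mathbb{R})\cap\dot H^1(\mathbb{R})\cap\dot H^s(\mathbb{R})$, i.e. the space of bounded functions $u$ with $u_x\in H^{s-1}(\mathbb{R})$, normed by $\|u\|_{L^\infty}+\|u_x\|_{H^{s-1}}$; and $\bar E^s_{2,2}=L^\infty\cap\dot H^{s-1}$, i.e. bounded functions $u$ with $|D|^{s-2}u_x\in L^2$, with the corresponding norm. The corresponding solution is the unique solution in $C([0,T];E^s_{2,2})\cap C^1([0,T];\bar E^s_{2,2})$; its maximal existence time $T^*\in(0,\infty]$ is the supremum of the $T>0$ for which it exists on $[0,T]$. "Blows up in finite time" means $T^*<\infty$. *)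

theory Defs
  imports "HOL-Analysis.Analysis"
begin

definition schwartz :: "(real \<Rightarrow> complex) \<Rightarrow> bool" where
  "schwartz \<phi> \<longleftrightarrow> (\<exists>D :: nat \<Rightarrow> real \<Rightarrow> complex. D 0 = \<phi> \<and>
     (\<forall>n x. (D n has_vector_derivative D (Suc n) x) (at x)) \<and>
     (\<forall>n k. bounded (range (\<lambda>x. x ^ k *\<^sub>R D n x))))"

definition fourier :: "(real \<Rightarrow> complex) \<Rightarrow> real \<Rightarrow> complex" where
  "fourier \<phi> x = (LINT \<xi>|lborel. \<phi> \<xi> * cis (- (\<xi> * x)))"

text \<open>
  \<open>multiplier_transform m u F\<close> says that the Fourier transform of \<open>m(D) u\<close>, as a tempered
  distribution, is the function \<open>F\<close>: by duality, \<open>m\<close> times the transform of \<open>u\<close>, tested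
  against \<open>\<phi>\<close>, is \<open>u\<close> tested against the classical transform of \<open>m \<phi>\<close>.
  For bounded \<open>u\<close> this makes sense whenever the transform of \<open>m \<phi>\<close> is integrable. That is the case
  for both symbols used below: the symbol \<open>\<i> \<xi>\<close> of \<open>d/dx\<close> (then it is a Schwartz function), and the
  symbol \<open>\<bar>\<xi>\<bar>\<^bsup>s-2\<^esup> \<i> \<xi>\<close> of \<open>\<bar>D\<bar>\<^bsup>s-2\<^esup> d/dx\<close> with \<open>s \<ge> 2\<close> (then it decays like
  \<open>\<bar>x\<bar>\<^bsup>-s\<^esup>\<close> or faster).
\<close>

definition multiplier_transform ::
    "(real \<Rightarrow> complex) \<Rightarrow> (real \<Rightarrow> real) \<Rightarrow> (real \<Rightarrow> complex) \<Rightarrow> bool" where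
  "multiplier_transform m u F \<longleftrightarrow> (\<forall>\<phi>. schwartz \<phi> \<longrightarrow>
     (LINT x|lborel. complex_of_real (u x) * fourier (\<lambda>\<xi>. m \<xi> * \<phi> \<xi>) x)
       = (LINT \<xi>|lborel. F \<xi> * \<phi> \<xi>))"

definition weighted_transform ::
    "(real \<Rightarrow> real) \<Rightarrow> (real \<Rightarrow> complex) \<Rightarrow> (real \<Rightarrow> real) \<Rightarrow> (real \<Rightarrow> complex) \<Rightarrow> bool" where
  "weighted_transform w m u F \<longleftrightarrow> F \<in> borel_measurable borel \<and>
     integrable lborel (\<lambda>\<xi>. w \<xi> * (cmod (F \<xi>))\<^sup>2) \<and> multiplier_transform m u F"

text \<open>
  The norm of \<open>m(D) u\<close> in \<open>L\<^sup>2\<close> with weight \<open>w\<close> on the Fourier side. The transform is determined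
  almost everywhere, so the choice below is immaterial; \<open>1 / (2 * pi)\<close> is Plancherel's constant.
\<close>

definition weighted_norm ::
    "(real \<Rightarrow> real) \<Rightarrow> (real \<Rightarrow> complex) \<Rightarrow> (real \<Rightarrow> real) \<Rightarrow> real" where
  "weighted_norm w m u =
     sqrt (1 / (2 * pi) *
       (LINT \<xi>|lborel. w \<xi> * (cmod ((SOME F. weighted_transform w m u F) \<xi>))\<^sup>2))"

definition sobolev_weight :: "real \<Rightarrow> real \<Rightarrow> real" where
  "sobolev_weight r \<xi> = (1 + \<xi>\<^sup>2) powr r"

definition ddx_symbol :: "real \<Rightarrow> complex" where
  "ddx_symbol \<xi> = \<i> * complex_of_real \<xi>"

definition absD_ddx_symbol :: "real \<Rightarrow> real \<Rightarrow> complex" where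
  "absD_ddx_symbol a \<xi> = complex_of_real (\<bar>\<xi>\<bar> powr a) * ddx_symbol \<xi>"

definition sup_norm :: "(real \<Rightarrow> real) \<Rightarrow> real" where
  "sup_norm u = (SUP x. \<bar>u x\<bar>)"

text \<open>
  The spaces \<open>E\<^sup>s\<close> and \<open>\<bar>E\<^sup>s\<close> for \<open>s \<ge> 2\<close>. In this range every class of almost everywhere
  equal functions in either space has exactly one continuous representative, and we identify the
  class with it; its supremum is the essential supremum. The derivative \<open>u\<^sub>x\<close> in the definition
  is the distributional one. For members of \<open>E_space s\<close> it lies in \<open>H\<^bsup>s-1\<^esup>\<close> with
  \<open>s - 1 \<ge> 1\<close>, so that the representative is continuously differentiable and its classical
  derivative represents \<open>u\<^sub>x\<close>.
\<close>

definition E_space :: "real \<Rightarrow> (real \<Rightarrow> real) set" where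
  "E_space s = {u. continuous_on UNIV u \<and> bounded (range u) \<and>
     (\<exists>F. weighted_transform (sobolev_weight (s - 1)) ddx_symbol u F)}"

definition E_norm :: "real \<Rightarrow> (real \<Rightarrow> real) \<Rightarrow> real" where
  "E_norm s u = sup_norm u + weighted_norm (sobolev_weight (s - 1)) ddx_symbol u"

definition Ebar_space :: "real \<Rightarrow> (real \<Rightarrow> real) set" where
  "Ebar_space s = {u. continuous_on UNIV u \<and> bounded (range u) \<and>
     (\<exists>F. weighted_transform (\<lambda>_. 1) (absD_ddx_symbol (s - 2)) u F)}"

definition Ebar_norm :: "real \<Rightarrow> (real \<Rightarrow> real) \<Rightarrow> real" where
  "Ebar_norm s u = sup_norm u + weighted_norm (\<lambda>_. 1) (absD_ddx_symbol (s - 2)) u"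

text \<open>
  Curves \<open>[0,T] \<rightarrow> X\<close> that are continuous, respectively continuously differentiable with
  derivative \<open>v\<close> (one-sided at the end points), for the norm \<open>N\<close> on the function space \<open>X\<close>.
\<close>

definition continuous_curve ::
    "(real \<Rightarrow> real) set \<Rightarrow> ((real \<Rightarrow> real) \<Rightarrow> real) \<Rightarrow> real \<Rightarrow> (real \<Rightarrow> real \<Rightarrow> real) \<Rightarrow> bool" where
  "continuous_curve X N T u \<longleftrightarrow> (\<forall>t\<in>{0..T}. u t \<in> X \<and>
     ((\<lambda>r. N (\<lambda>x. u r x - u t x)) \<longlongrightarrow> 0) (at t within {0..T}))"

definition C1_curve ::
    "(real \<Rightarrow> real) set \<Rightarrow> ((real \<Rightarrow> real) \<Rightarrow> real) \<Rightarrow> real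
      \<Rightarrow> (real \<Rightarrow> real \<Rightarrow> real) \<Rightarrow> (real \<Rightarrow> real \<Rightarrow> real) \<Rightarrow> bool" where
  "C1_curve X N T u v \<longleftrightarrow> continuous_curve X N T u \<and> continuous_curve X N T v \<and>
     (\<forall>t\<in>{0..T}.
       ((\<lambda>r. N (\<lambda>x. (u r x - u t x) / (r - t) - v t x)) \<longlongrightarrow> 0) (at t within {0..T}))"

definition is_solution ::
    "real \<Rightarrow> (real \<Rightarrow> real) \<Rightarrow> (real \<Rightarrow> real) \<Rightarrow> real \<Rightarrow> (real \<Rightarrow> real \<Rightarrow> real) \<Rightarrow> bool" where
  "is_solution s g u0 T u \<longleftrightarrow>
     continuous_curve (E_space s) (E_norm s) T u \<and>
     (\<exists>ut. C1_curve (Ebar_space s) (Ebar_norm s) T u ut \<and>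
       (\<forall>t\<in>{0..T}. \<forall>x.
          ut t x + u t x * deriv (u t) x
            = (LINT z:{..x}|lborel. 1 / 2 * (deriv (u t) z)\<^sup>2) + g t)) \<and>
     u 0 = u0"

definition max_existence_time :: "real \<Rightarrow> (real \<Rightarrow> real) \<Rightarrow> (real \<Rightarrow> real) \<Rightarrow> ereal" where
  "max_existence_time s g u0 = Sup {ereal T |T. T > 0 \<and> (\<exists>u. is_solution s g u0 T u)}"

definition blows_up_in_finite_time :: "real \<Rightarrow> (real \<Rightarrow> real) \<Rightarrow> (real \<Rightarrow> real) \<Rightarrow> bool" where
  "blows_up_in_finite_time s g u0 \<longleftrightarrow> max_existence_time s g u0 < \<infinity>"

end

theory Submission
  imports Defs "HOL-Probability.Sinc_Integral"
    "HOL-Probability.Characteristic_Functions" "HOL-Real_Asymp.Real_Asymp"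
begin

text \<open>
  Along a characteristic \<open>q' = u(t, q)\<close> the slope \<open>m(t) = u\<^sub>x(t, q(t))\<close> satisfies
  \<open>m' = - m\<^sup>2 / 2\<close>, because differentiating the equation in \<open>x\<close> gives
  \<open>u\<^sub>t\<^sub>x + u u\<^sub>x\<^sub>x + u\<^sub>x\<^sup>2 = u\<^sub>x\<^sup>2 / 2\<close> and \<open>g\<close> drops out. A negative slope at \<open>x0\<close>
  therefore reaches \<open>- \<infinity>\<close> no later than at time \<open>2 / - u\<^sub>0\<^sub>x(x0)\<close>, whereas \<open>u\<^sub>x\<close> stays
  bounded on every interval on which the solution exists. On the Fourier side,
  \<open>(1 + \<xi>\<^sup>2) \<bar>F\<bar>\<^sup>2\<close> being integrable makes the transform \<open>F\<close> of \<open>u\<^sub>x\<close> integrable, so that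
  convergence in \<open>E\<^sup>s\<close> is uniform convergence of \<open>u\<close> and \<open>u\<^sub>x\<close>.
\<close>

section \<open>Schwartz functions and their Fourier transforms\<close>

lemma integrable_inverse_1_plus_square':
  "integrable lborel (\<lambda>x::real. inverse (1 + x\<^sup>2))"
  using integrable_inverse_1_plus_square by (simp add: set_integrable_def)

lemma integral_inverse_1_plus_square:
  "(LINT x|lborel. inverse (1 + x\<^sup>2)) = (pi::real)"
  using LBINT_inverse_1_plus_square
  by (simp add: interval_lebesgue_integral_def set_lebesgue_integral_def)

definition schwartz_derivs :: "(nat \<Rightarrow> real \<Rightarrow> complex) \<Rightarrow> bool" where
  "schwartz_derivs D \<longleftrightarrow>
     (\<forall>n x. (D n has_vector_derivative D (Suc n) x) (at x)) \<and>
     (\<forall>n k. bounded (range (\<lambda>x. x ^ k *\<^sub>R D n x)))"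

lemma schwartz_iff_derivs: "schwartz \<phi> \<longleftrightarrow> (\<exists>D. D 0 = \<phi> \<and> schwartz_derivs D)"
  by (simp add: schwartz_def schwartz_derivs_def)

lemma schwartz_derivs_deriv:
  "schwartz_derivs D \<Longrightarrow> (D n has_vector_derivative D (Suc n) x) (at x)"
  by (simp add: schwartz_derivs_def)

lemma schwartz_derivs_continuous: "schwartz_derivs D \<Longrightarrow> continuous_on A (D n)"
  by (meson continuous_at_imp_continuous_on has_vector_derivative_continuous schwartz_derivs_deriv)

lemma schwartz_derivs_decay:
  assumes "schwartz_derivs D"
  obtains C where "C \<ge> 0" "\<And>x. cmod (D n x) \<le> C * inverse (1 + x\<^sup>2)"
proof -
  have "bounded (range (\<lambda>x. x ^ 0 *\<^sub>R D n x))" "bounded (range (\<lambda>x. x ^ 2 *\<^sub>R D n x))"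
    using assms unfolding schwartz_derivs_def by blast+
  then obtain A B where A: "\<And>x. cmod (D n x) \<le> A" and B: "\<And>x. x\<^sup>2 * cmod (D n x) \<le> B"
    unfolding bounded_iff by (force simp: abs_mult power2_eq_square)
  have "cmod (D n x) \<le> (A + B) * inverse (1 + x\<^sup>2)" for x
  proof -
    have "cmod (D n x) * (1 + x\<^sup>2) \<le> A + B"
      using A[of x] B[of x] by (simp add: algebra_simps)
    moreover have "0 < 1 + x\<^sup>2" by (simp add: add_pos_nonneg)
    ultimately show ?thesis by (simp add: divide_simps)
  qed
  moreover have "0 \<le> A + B"
    using order_trans[OF norm_ge_zero A[of 0]] B[of 0] by simp
  ultimately show ?thesis using that by blast
qed

lemma schwartz_derivs_integrable:
  assumes "schwartz_derivs D"
  shows "integrable lborel (D n)"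
proof -
  obtain C where C: "C \<ge> 0" "\<And>x. cmod (D n x) \<le> C * inverse (1 + x\<^sup>2)"
    using schwartz_derivs_decay[OF assms] by metis
  show ?thesis
  proof (rule Bochner_Integration.integrable_bound)
    show "integrable lborel (\<lambda>x::real. C * inverse (1 + x\<^sup>2))"
      using integrable_inverse_1_plus_square' by simp
    show "D n \<in> borel_measurable lborel"
      using schwartz_derivs_continuous[OF assms] by (simp add: borel_measurable_continuous_onI)
    show "AE x in lborel. norm (D n x) \<le> norm (C * inverse (1 + x\<^sup>2))"
      using C by (intro AE_I2) (simp add: order_trans[OF C(2)])
  qed
qed

lemma schwartz_derivs_tendsto:
  assumes "schwartz_derivs D"
  shows "(D n \<longlongrightarrow> 0) at_top" "(D n \<longlongrightarrow> 0) at_bot"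
proof -
  obtain C where C: "C \<ge> 0" "\<And>x. cmod (D n x) \<le> C * inverse (1 + x\<^sup>2)"
    using schwartz_derivs_decay[OF assms] by metis
  have "((\<lambda>x. C * inverse (1 + x\<^sup>2)) \<longlongrightarrow> 0) at_top" "((\<lambda>x. C * inverse (1 + x\<^sup>2)) \<longlongrightarrow> 0) at_bot"
    by real_asymp+
  then show "(D n \<longlongrightarrow> 0) at_top" "(D n \<longlongrightarrow> 0) at_bot"
    by (auto intro!: Lim_null_comparison[where g="\<lambda>x. C * inverse (1 + x\<^sup>2)"] always_eventually C(2))
qed

lemma integral_derivative_eq_0:
  fixes G g :: "real \<Rightarrow> complex"
  assumes "\<And>x. (G has_vector_derivative g x) (at x)" "continuous_on UNIV g" "integrable lborel g"
    and "(G \<longlongrightarrow> 0) at_top" "(G \<longlongrightarrow> 0) at_bot"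
  shows "(LINT x|lborel. g x) = 0"
proof -
  have "(LBINT x=-\<infinity>..\<infinity>. g x) = 0 - 0"
  proof (rule interval_integral_FTC_integrable)
    show "isCont g x" for x
      using assms(2) continuous_on_eq_continuous_at by blast
    show "set_integrable lborel (einterval (-\<infinity>) \<infinity>) g"
      using assms(3) by (simp add: set_integrable_def)
    show "((G \<circ> real_of_ereal) \<longlongrightarrow> 0) (at_right (-\<infinity>))" "((G \<circ> real_of_ereal) \<longlongrightarrow> 0) (at_left \<infinity>)"
      using assms(4,5) by (simp_all add: ereal_tendsto_simps1)
  qed (use assms in auto)
  then show ?thesis
    by (simp add: interval_lebesgue_integral_def set_lebesgue_integral_def)
qed

lemma integrable_mult_cis:
  fixes f :: "real \<Rightarrow> complex"
  assumes "integrable lborel f"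
  shows "integrable lborel (\<lambda>\<xi>. f \<xi> * cis (c * \<xi>))"
proof (rule Bochner_Integration.integrable_bound[OF assms])
  have "(\<lambda>\<xi>. cis (c * \<xi>)) \<in> borel_measurable borel"
    by (intro borel_measurable_continuous_onI continuous_intros)
  then show "(\<lambda>\<xi>. f \<xi> * cis (c * \<xi>)) \<in> borel_measurable lborel"
    using assms by auto
qed (simp add: norm_mult)

lemma fourier_derivative:
  assumes D: "schwartz_derivs D"
  shows "fourier (D (Suc n)) x = \<i> * x * fourier (D n) x"
proof -
  let ?G = "\<lambda>\<xi>. D n \<xi> * cis (- x * \<xi>)"
  let ?g = "\<lambda>\<xi>. D (Suc n) \<xi> * cis (- x * \<xi>) - \<i> * x * (D n \<xi> * cis (- x * \<xi>))"
  have i: "integrable lborel (\<lambda>\<xi>. D m \<xi> * cis (- x * \<xi>))" for m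
    by (intro integrable_mult_cis schwartz_derivs_integrable D)
  have "(LINT \<xi>|lborel. ?g \<xi>) = 0"
  proof (rule integral_derivative_eq_0)
    show "(?G has_vector_derivative ?g \<xi>) (at \<xi>)" for \<xi>
    proof -
      have "((\<lambda>\<xi>. cis (- x * \<xi>)) has_vector_derivative (- x) *\<^sub>R (\<i> * cis (- x * \<xi>))) (at \<xi>)"
      proof -
        have "((\<lambda>z. exp (- \<i> * x * z)) has_field_derivative - \<i> * x * exp (- \<i> * x * \<xi>)) (at (of_real \<xi>))"
          by (auto intro!: derivative_eq_intros)
        from has_vector_derivative_real_field[OF this] show ?thesis
          by (simp add: cis_conv_exp scaleR_conv_of_real algebra_simps)
      qed
      from has_vector_derivative_mult[OF schwartz_derivs_deriv[OF D] this, of n]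
      show ?thesis by (simp add: algebra_simps scaleR_conv_of_real)
    qed
    show "continuous_on UNIV ?g"
      by (intro continuous_intros schwartz_derivs_continuous[OF D])
    show "integrable lborel ?g" using i by auto
    have "((\<lambda>\<xi>. cmod (?G \<xi>)) \<longlongrightarrow> 0) at_top" "((\<lambda>\<xi>. cmod (?G \<xi>)) \<longlongrightarrow> 0) at_bot"
      using schwartz_derivs_tendsto[OF D, of n] by (auto simp: norm_mult tendsto_norm_zero_iff)
    then show "(?G \<longlongrightarrow> 0) at_top" "(?G \<longlongrightarrow> 0) at_bot"
      by (auto simp: tendsto_norm_zero_iff)
  qed
  then show ?thesis
    using i by (simp add: fourier_def Bochner_Integration.integral_diff mult.commute)
qed

lemma fourier_bound: "cmod (fourier \<phi> x) \<le> (LINT \<xi>|lborel. cmod (\<phi> \<xi>))"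
proof -
  have "cmod (fourier \<phi> x) \<le> (LINT \<xi>|lborel. cmod (\<phi> \<xi> * cis (- (\<xi> * x))))"
    unfolding fourier_def by (rule integral_norm_bound)
  then show ?thesis by (simp add: norm_mult)
qed

lemma borel_measurable_fourier:
  assumes [measurable]: "\<phi> \<in> borel_measurable borel"
  shows "fourier \<phi> \<in> borel_measurable borel"
proof -
  have [measurable]: "cis \<in> borel_measurable borel"
    by (intro borel_measurable_continuous_onI continuous_intros)
  have "(\<lambda>x. LINT \<xi>|lborel. \<phi> \<xi> * cis (- (\<xi> * x))) \<in> borel_measurable borel"
    by measurable
  then show ?thesis by (simp add: fourier_def[abs_def])
qed

lemma integrable_fourier:
  assumes D: "schwartz_derivs D"
  shows "integrable lborel (fourier (D 0))"
proof -
  define C where "C = (LINT \<xi>|lborel. cmod (D 0 \<xi>)) + (LINT \<xi>|lborel. cmod (D 2 \<xi>))"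
  have "cmod (fourier (D 0) x) \<le> C * inverse (1 + x\<^sup>2)" for x
  proof -
    have "fourier (D 2) x = - (x\<^sup>2) * fourier (D 0) x"
      using fourier_derivative[OF D, of 0 x] fourier_derivative[OF D, of 1 x]
      by (simp add: numeral_2_eq_2) (simp add: power2_eq_square complex_eq_iff)
    then have "x\<^sup>2 * cmod (fourier (D 0) x) = cmod (fourier (D 2) x)"
      by (simp add: norm_mult norm_power)
    then have "(1 + x\<^sup>2) * cmod (fourier (D 0) x) \<le> C"
      using fourier_bound[of "D 0" x] fourier_bound[of "D 2" x] by (simp add: C_def algebra_simps)
    moreover have "0 < 1 + x\<^sup>2" by (simp add: add_pos_nonneg)
    ultimately show ?thesis by (simp add: divide_simps mult.commute)
  qed
  then show ?thesis
    by (intro Bochner_Integration.integrable_bound[OF integrable_mult_right[OF integrable_inverse_1_plus_square', of C]])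
       (auto intro!: borel_measurable_fourier borel_measurable_continuous_onI[OF schwartz_derivs_continuous[OF D]]
          AE_I2 intro: order_trans[OF _ abs_ge_self])
qed

lemma schwartz_derivs_ddx:
  assumes D: "schwartz_derivs D"
  shows "schwartz_derivs (\<lambda>n \<xi>. \<i> * \<xi> * D n \<xi> + \<i> * of_nat n * D (n - 1) \<xi>)"
  unfolding schwartz_derivs_def
proof (intro conjI allI)
  fix n and x :: real
  have 1: "((\<lambda>\<xi>. \<i> * complex_of_real \<xi>) has_vector_derivative \<i>) (at x)"
    by (auto intro!: derivative_eq_intros simp: has_vector_derivative_def fun_eq_iff scaleR_conv_of_real)
  have 2: "((\<lambda>\<xi>. \<i> * of_nat n * D (n - 1) \<xi>) has_vector_derivative \<i> * of_nat n * D n x) (at x)"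
  proof (cases n)
    case (Suc m)
    show ?thesis unfolding Suc
      using has_vector_derivative_mult_right[OF schwartz_derivs_deriv[OF D, of m x], of "\<i> * of_nat (Suc m)"] by simp
  qed simp
  show "((\<lambda>\<xi>. \<i> * \<xi> * D n \<xi> + \<i> * of_nat n * D (n - 1) \<xi>) has_vector_derivative
          \<i> * x * D (Suc n) x + \<i> * of_nat (Suc n) * D (Suc n - 1) x) (at x)"
    using has_vector_derivative_add[OF has_vector_derivative_mult[OF 1 schwartz_derivs_deriv[OF D, of n x]] 2]
    by (simp add: algebra_simps)
next
  fix n k
  have b: "bounded (range (\<lambda>x. x ^ k *\<^sub>R D n x))" for n k
    using D by (simp add: schwartz_derivs_def)
  obtain A B where A: "\<And>x. cmod (x ^ Suc k *\<^sub>R D n x) \<le> A" 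
    and B: "\<And>x. cmod (x ^ k *\<^sub>R D (n - 1) x) \<le> B"
    using b[of "Suc k" n] b[of k "n-1"] unfolding bounded_iff by blast
  show "bounded (range (\<lambda>x. x ^ k *\<^sub>R (\<i> * complex_of_real x * D n x + \<i> * of_nat n * D (n - 1) x)))"
  proof (rule boundedI, clarify)
    fix x
    have "cmod (x ^ k *\<^sub>R (\<i> * complex_of_real x * D n x + \<i> * of_nat n * D (n - 1) x))
      = cmod (\<i> * (x ^ Suc k *\<^sub>R D n x) + \<i> * (of_nat n * (x ^ k *\<^sub>R D (n - 1) x)))"
      by (simp add: scaleR_conv_of_real algebra_simps)
    also have "\<dots> \<le> cmod (x ^ Suc k *\<^sub>R D n x) + n * cmod (x ^ k *\<^sub>R D (n - 1) x)"
      by (rule order_trans[OF norm_triangle_ineq]) (simp add: norm_mult)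
    also have "\<dots> \<le> A + n * B"
      by (intro add_mono mult_left_mono A B) auto
    finally show "cmod (x ^ k *\<^sub>R (\<i> * complex_of_real x * D n x + \<i> * of_nat n * D (n - 1) x)) \<le> A + n * B" .
  qed
qed

lemma integrable_bounded_mult:
  fixes u :: "'a \<Rightarrow> real" and f :: "'a \<Rightarrow> complex"
  assumes "integrable M f" "u \<in> borel_measurable M" "bounded (range u)"
  shows "integrable M (\<lambda>x. complex_of_real (u x) * f x)"
proof -
  obtain B where "\<And>x. norm (u x) \<le> B" using assms(3) by (auto simp: bounded_iff)
  then have B: "\<And>x. \<bar>u x\<bar> \<le> \<bar>B\<bar>" by (metis abs_ge_self order_trans real_norm_def)
  show ?thesis
    by (rule Bochner_Integration.integrable_bound[OF integrable_mult_right[OF integrable_norm[OF assms(1)], of "\<bar>B\<bar>"]])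
       (use assms B in \<open>auto simp: norm_mult abs_mult intro!: mult_right_mono\<close>)
qed

lemma integrable_ddx_pairing:
  assumes "schwartz \<phi>" "continuous_on UNIV u" "bounded (range u)"
  shows "integrable lborel (\<lambda>x. complex_of_real (u x) * fourier (\<lambda>\<xi>. ddx_symbol \<xi> * \<phi> \<xi>) x)"
proof -
  obtain D where D: "D 0 = \<phi>" "schwartz_derivs D"
    using assms(1) by (auto simp: schwartz_iff_derivs)
  show ?thesis
    using integrable_fourier[OF schwartz_derivs_ddx[OF D(2)]] D(1)
    by (intro integrable_bounded_mult)
       (use assms in \<open>auto simp: ddx_symbol_def borel_measurable_continuous_onI\<close>)
qed

section \<open>Gaussian test functions\<close>

primrec gaussian_poly :: "real \<Rightarrow> real \<Rightarrow> nat \<Rightarrow> complex poly" where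
  "gaussian_poly y c 0 = 1"
| "gaussian_poly y c (Suc n) =
     pderiv (gaussian_poly y c n) + [:\<i> * y, - complex_of_real c:] * gaussian_poly y c n"

definition modulated_gaussian :: "real \<Rightarrow> real \<Rightarrow> real \<Rightarrow> complex" where
  "modulated_gaussian y c \<xi> = complex_of_real (exp (- (c * \<xi>\<^sup>2 / 2))) * cis (y * \<xi>)"


lemma power_exp_bound:
  fixes c x :: real
  assumes "c > 0"
  shows "\<bar>x\<bar> ^ k * exp (- (c * x\<^sup>2 / 2)) \<le> 1 + fact k * (2 / c) ^ k"
proof -
  define z where "z = c * x\<^sup>2 / 2"
  have z: "z \<ge> 0" using assms by (simp add: z_def)
  have "(\<Sum>j\<in>{k}. z ^ j /\<^sub>R fact j) \<le> exp z"
    unfolding exp_def using z summable_exp_generic[of z]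
    by (intro sum_le_suminf) auto
  then have "z ^ k * exp (- z) \<le> fact k"
    by (simp add: exp_minus field_simps)
  moreover have "x ^ (2 * k) = (2 / c) ^ k * z ^ k"
    using assms by (simp add: z_def power_mult flip: power_mult_distrib)
  ultimately have "x ^ (2 * k) * exp (- z) \<le> fact k * (2 / c) ^ k"
    using assms by (simp add: mult.assoc mult.left_commute mult_left_mono)
  moreover have "\<bar>x\<bar> ^ k * exp (- z) \<le> (1 + x ^ (2 * k)) * exp (- z)"
  proof -
    have "\<bar>x\<bar> ^ k \<le> 1 + (\<bar>x\<bar> ^ k)\<^sup>2"
      using zero_le_power2[of "\<bar>x\<bar> ^ k - 1"] zero_le_power[OF abs_ge_zero, of x k]
      unfolding power2_diff power_one by linarith
    also have "(\<bar>x\<bar> ^ k)\<^sup>2 = x ^ (2 * k)"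
      by (simp add: power_mult[symmetric] mult.commute[of k] power_even_abs)
    finally show ?thesis by (intro mult_right_mono) auto
  qed
  moreover have "exp (- z) \<le> 1" using z by simp
  ultimately show ?thesis unfolding z_def[symmetric] distrib_right mult_1_left by linarith
qed

lemma bounded_poly_gaussian:
  assumes "c > 0"
  shows "bounded (range (\<lambda>x. x ^ k *\<^sub>R (poly p (complex_of_real x) * modulated_gaussian y c x)))"
proof (induction p arbitrary: k)
  case (pCons a p)
  obtain B where B: "\<And>x. cmod (x ^ Suc k *\<^sub>R (poly p (complex_of_real x) * modulated_gaussian y c x)) \<le> B"
    using pCons(2)[of "Suc k"] unfolding bounded_iff by blast
  show ?case
  proof (rule boundedI, clarify)
    fix x
    have "cmod (x ^ k *\<^sub>R (poly (pCons a p) (complex_of_real x) * modulated_gaussian y c x)) =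
      cmod (a * (x ^ k *\<^sub>R modulated_gaussian y c x) + x ^ Suc k *\<^sub>R (poly p (complex_of_real x) * modulated_gaussian y c x))"
      by (simp add: scaleR_conv_of_real algebra_simps)
    also have "\<dots> \<le> cmod a * (\<bar>x\<bar> ^ k * exp (- (c * x\<^sup>2 / 2))) + B"
      using B[of x] by (intro order_trans[OF norm_triangle_ineq] add_mono)
        (simp_all add: norm_mult modulated_gaussian_def power_abs)
    also have "\<dots> \<le> cmod a * (1 + fact k * (2 / c) ^ k) + B"
      by (intro add_mono mult_left_mono power_exp_bound assms) auto
    finally show "cmod (x ^ k *\<^sub>R (poly (pCons a p) (complex_of_real x) * modulated_gaussian y c x))
      \<le> cmod a * (1 + fact k * (2 / c) ^ k) + B" .
  qed
qed auto

lemma schwartz_derivs_gaussian: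
  assumes "c > 0"
  shows "schwartz_derivs (\<lambda>n \<xi>. poly (gaussian_poly y c n) (complex_of_real \<xi>) * modulated_gaussian y c \<xi>)"
  unfolding schwartz_derivs_def
proof (intro conjI allI bounded_poly_gaussian[OF assms])
  fix n and x :: real
  have eq: "modulated_gaussian y c \<xi> = exp (\<i> * y * \<xi> - c * \<xi>\<^sup>2 / 2)" for \<xi>
    by (simp add: modulated_gaussian_def cis_conv_exp exp_of_real[symmetric] exp_add[symmetric] mult.assoc del: exp_of_real)
  have "((\<lambda>z. poly (gaussian_poly y c n) z * exp (\<i> * y * z - c * z\<^sup>2 / 2)) has_field_derivative
     poly (gaussian_poly y c (Suc n)) x * exp (\<i> * y * x - c * (of_real x)\<^sup>2 / 2)) (at (of_real x))"
    by (auto intro!: derivative_eq_intros poly_DERIV simp: algebra_simps)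
  from has_vector_derivative_real_field[OF this]
  show "((\<lambda>\<xi>. poly (gaussian_poly y c n) (complex_of_real \<xi>) * modulated_gaussian y c \<xi>) has_vector_derivative
         poly (gaussian_poly y c (Suc n)) x * modulated_gaussian y c x) (at x)"
    by (simp add: eq)
qed

lemma schwartz_gaussian: "c > 0 \<Longrightarrow> schwartz (modulated_gaussian y c)"
  unfolding schwartz_iff_derivs
  by (intro exI[of _ "\<lambda>n \<xi>. poly (gaussian_poly y c n) (complex_of_real \<xi>) * modulated_gaussian y c \<xi>"]
        conjI schwartz_derivs_gaussian) auto

lemma fourier_gaussian:
  assumes "\<sigma> > 0"
  shows "fourier (modulated_gaussian y (\<sigma>\<^sup>2)) x = complex_of_real (2 * pi * normal_density y \<sigma> x)"
proof -
  define t where "t = (y - x) / \<sigma>"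
  have [measurable]: "(\<lambda>x. cis (t * x)) \<in> borel_measurable borel"
    by (intro borel_measurable_continuous_onI continuous_intros)
  have "complex_of_real (exp (- (t\<^sup>2) / 2)) = (CLINT \<eta>|std_normal_distribution. cis (t * \<eta>))"
    using fun_cong[OF char_std_normal_distribution, of t] by (simp add: char_def cis_conv_exp mult.commute)
  also have "\<dots> = (LINT \<eta>|lborel. std_normal_density \<eta> *\<^sub>R cis (t * \<eta>))"
    by (subst integral_density) auto
  also have "\<dots> = \<bar>\<sigma>\<bar> *\<^sub>R (LINT \<xi>|lborel. std_normal_density (0 + \<sigma> * \<xi>) *\<^sub>R cis (t * (0 + \<sigma> * \<xi>)))"
    using assms by (intro lborel_integral_real_affine) auto
  also have "(LINT \<xi>|lborel. std_normal_density (0 + \<sigma> * \<xi>) *\<^sub>R cis (t * (0 + \<sigma> * \<xi>)))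
    = (LINT \<xi>|lborel. complex_of_real (1 / sqrt (2 * pi)) * (modulated_gaussian y (\<sigma>\<^sup>2) \<xi> * cis (- (\<xi> * x))))"
  proof (intro Bochner_Integration.integral_cong refl)
    fix \<xi> :: real
    have "t * (0 + \<sigma> * \<xi>) = y * \<xi> + - (\<xi> * x)"
      using assms by (simp add: t_def field_simps)
    then have "cis (t * (0 + \<sigma> * \<xi>)) = cis (y * \<xi>) * cis (- (\<xi> * x))"
      by (simp only: cis_mult)
    then show "std_normal_density (0 + \<sigma> * \<xi>) *\<^sub>R cis (t * (0 + \<sigma> * \<xi>)) =
      complex_of_real (1 / sqrt (2 * pi)) * (modulated_gaussian y (\<sigma>\<^sup>2) \<xi> * cis (- (\<xi> * x)))"
      by (simp add: std_normal_density_def modulated_gaussian_def scaleR_conv_of_real power_mult_distrib)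
  qed
  also have "\<dots> = complex_of_real (1 / sqrt (2 * pi)) * fourier (modulated_gaussian y (\<sigma>\<^sup>2)) x"
    by (simp add: fourier_def)
  finally have "complex_of_real (exp (- (t\<^sup>2) / 2)) =
    complex_of_real (\<sigma> / sqrt (2 * pi)) * fourier (modulated_gaussian y (\<sigma>\<^sup>2)) x"
    using assms by (simp add: scaleR_conv_of_real)
  then have "fourier (modulated_gaussian y (\<sigma>\<^sup>2)) x = complex_of_real (sqrt (2 * pi) / \<sigma> * exp (- (t\<^sup>2) / 2))"
    using assms by (simp add: field_simps)
  also have "sqrt (2 * pi) / \<sigma> * exp (- (t\<^sup>2) / 2) = 2 * pi * normal_density y \<sigma> x"
  proof -
    have "sqrt (2 * pi) * sqrt (2 * pi) = 2 * pi" by simp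
    then show ?thesis
      using assms
      by (simp add: normal_density_def t_def real_sqrt_mult power_divide power2_commute[of x y] field_simps)
  qed
  finally show ?thesis .
qed

lemma fourier_ddx_gaussian:
  assumes "\<sigma> > 0"
  shows "fourier (\<lambda>\<xi>. ddx_symbol \<xi> * modulated_gaussian y (\<sigma>\<^sup>2) \<xi>) x =
    complex_of_real (2 * pi * ((x - y) / \<sigma>\<^sup>2 * normal_density y \<sigma> x))"
proof -
  define D where "D = (\<lambda>n \<xi>. poly (gaussian_poly y (\<sigma>\<^sup>2) n) (complex_of_real \<xi>) * modulated_gaussian y (\<sigma>\<^sup>2) \<xi>)"
  have D: "schwartz_derivs D" unfolding D_def using assms by (intro schwartz_derivs_gaussian) simp
  have i: "integrable lborel (\<lambda>\<xi>. D n \<xi> * cis (- (\<xi> * x)))" for n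
    using integrable_mult_cis[OF schwartz_derivs_integrable[OF D], of n "-x"] by (simp add: mult.commute)
  have D0: "D 0 = modulated_gaussian y (\<sigma>\<^sup>2)" by (simp add: D_def)
  have "ddx_symbol \<xi> * modulated_gaussian y (\<sigma>\<^sup>2) \<xi> = - (y / \<sigma>\<^sup>2) * D 0 \<xi> - \<i> / \<sigma>\<^sup>2 * D 1 \<xi>" for \<xi>
    using assms by (simp add: D_def ddx_symbol_def field_simps)
  then have "fourier (\<lambda>\<xi>. ddx_symbol \<xi> * modulated_gaussian y (\<sigma>\<^sup>2) \<xi>) x
     = (LINT \<xi>|lborel. - (y / \<sigma>\<^sup>2) * (D 0 \<xi> * cis (- (\<xi> * x))) - \<i> / \<sigma>\<^sup>2 * (D 1 \<xi> * cis (- (\<xi> * x))))"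
    unfolding fourier_def by (simp only: left_diff_distrib mult.assoc)
  also have "\<dots> = - (y / \<sigma>\<^sup>2) * fourier (D 0) x - \<i> / \<sigma>\<^sup>2 * fourier (D 1) x"
    using i by (simp add: fourier_def)
  also have "\<dots> = (x - y) / \<sigma>\<^sup>2 * fourier (D 0) x"
    using fourier_derivative[OF D, of 0 x] assms by (simp add: field_simps)
  finally show ?thesis
    unfolding D0 fourier_gaussian[OF assms] by simp
qed

definition inverse_fourier :: "(real \<Rightarrow> complex) \<Rightarrow> real \<Rightarrow> complex" where
  "inverse_fourier F x = (LINT \<xi>|lborel. F \<xi> * cis (x * \<xi>)) / (2 * pi)"

lemma multiplier_transform_gaussian:
  assumes "multiplier_transform ddx_symbol u F" "\<sigma> > 0"
  shows "complex_of_real (LINT x|lborel. u x * ((x - y) / \<sigma>\<^sup>2 * normal_density y \<sigma> x)) =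
    inverse_fourier (\<lambda>\<xi>. F \<xi> * complex_of_real (exp (- (\<sigma>\<^sup>2 * \<xi>\<^sup>2 / 2)))) y"
proof -
  have "schwartz (modulated_gaussian y (\<sigma>\<^sup>2))" using assms(2) by (intro schwartz_gaussian) simp
  then have "(LINT \<xi>|lborel. F \<xi> * modulated_gaussian y (\<sigma>\<^sup>2) \<xi>) =
     (LINT x|lborel. complex_of_real (u x) * fourier (\<lambda>\<xi>. ddx_symbol \<xi> * modulated_gaussian y (\<sigma>\<^sup>2) \<xi>) x)"
    using assms(1) by (simp add: multiplier_transform_def)
  also have "\<dots> = (LINT x|lborel. complex_of_real (2 * pi) * complex_of_real (u x * ((x - y) / \<sigma>\<^sup>2 * normal_density y \<sigma> x)))"
    unfolding fourier_ddx_gaussian[OF assms(2)]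
    by (intro Bochner_Integration.integral_cong) simp_all
  also have "\<dots> = complex_of_real (2 * pi) * complex_of_real (LINT x|lborel. u x * ((x - y) / \<sigma>\<^sup>2 * normal_density y \<sigma> x))"
    by (simp only: integral_mult_right_zero integral_complex_of_real)
  finally show ?thesis
    by (simp add: inverse_fourier_def modulated_gaussian_def mult.assoc)
qed

section \<open>Classical derivatives from multiplier transforms\<close>

lemma integrable_normal_density_mult:
  fixes u :: "real \<Rightarrow> real"
  assumes "continuous_on UNIV u" "bounded (range u)" "\<sigma> > 0"
  shows "integrable lborel (\<lambda>x. u x * normal_density y \<sigma> x)"
proof -
  obtain M where M: "\<And>x. \<bar>u x\<bar> \<le> M" using assms(2) by (auto simp: bounded_iff)
  have [measurable]: "u \<in> borel_measurable borel" using assms(1) by (rule borel_measurable_continuous_onI)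
  have "integrable lborel (\<lambda>x. M * normal_density y \<sigma> x)" using assms(3) by simp
  then show ?thesis
    by (rule Bochner_Integration.integrable_bound)
       (auto simp: abs_mult intro!: AE_I2 mult_right_mono intro: order_trans[OF M abs_ge_self])
qed

lemma normal_density_convolution_tendsto:
  fixes u :: "real \<Rightarrow> real"
  assumes "continuous_on UNIV u" "bounded (range u)"
    and \<sigma>: "\<And>n. \<sigma> n > 0" "\<sigma> \<longlonglongrightarrow> 0"
  shows "(\<lambda>n. LINT x|lborel. u x * normal_density y (\<sigma> n) x) \<longlonglongrightarrow> u y"
proof -
  obtain M where M: "\<And>x. \<bar>u x\<bar> \<le> M" using assms(2) by (auto simp: bounded_iff)
  have [measurable]: "u \<in> borel_measurable borel" using assms(1) by (rule borel_measurable_continuous_onI)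
  have eq: "(LINT x|lborel. u x * normal_density y (\<sigma> n) x) =
    (LINT z|lborel. u (y + \<sigma> n * z) * std_normal_density z)" for n
  proof -
    have "(LINT x|lborel. u x * normal_density y (\<sigma> n) x) =
      \<bar>\<sigma> n\<bar> *\<^sub>R (LINT z|lborel. u (y + \<sigma> n * z) * normal_density y (\<sigma> n) (y + \<sigma> n * z))"
      using \<sigma>(1)[of n] by (intro lborel_integral_real_affine) auto
    also have "\<dots> = (LINT z|lborel. \<bar>\<sigma> n\<bar> * (u (y + \<sigma> n * z) * normal_density y (\<sigma> n) (y + \<sigma> n * z)))"
      by simp
    also have "\<dots> = (LINT z|lborel. u (y + \<sigma> n * z) * std_normal_density z)"
      using \<sigma>(1)[of n]
      by (intro Bochner_Integration.integral_cong)
         (auto simp: normal_density_def real_sqrt_mult power_mult_distrib)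
    finally show ?thesis .
  qed
  have "(\<lambda>n. LINT z|lborel. u (y + \<sigma> n * z) * std_normal_density z) \<longlonglongrightarrow>
    (LINT z|lborel. u y * std_normal_density z)"
  proof (rule integral_dominated_convergence[where w="\<lambda>z. M * std_normal_density z"])
    show "AE z in lborel. (\<lambda>n. u (y + \<sigma> n * z) * std_normal_density z) \<longlonglongrightarrow> u y * std_normal_density z"
    proof (intro AE_I2 tendsto_mult tendsto_const)
      fix z
      have "(\<lambda>n. y + \<sigma> n * z) \<longlonglongrightarrow> y + 0 * z" by (intro tendsto_intros \<sigma>)
      then show "(\<lambda>n. u (y + \<sigma> n * z)) \<longlonglongrightarrow> u y"
        using assms(1) by (auto intro: isCont_tendsto_compose simp: continuous_on_eq_continuous_at)
    qed
    show "AE z in lborel. norm (u (y + \<sigma> n * z) * std_normal_density z) \<le> M * std_normal_density z" for n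
      using M by (intro AE_I2) (simp add: abs_mult mult_right_mono)
  qed auto
  then show ?thesis by (simp add: eq)
qed

lemma normal_density_mean_derivative:
  assumes "\<sigma> > 0"
  shows "((\<lambda>y. normal_density y \<sigma> x) has_real_derivative (x - y) / \<sigma>\<^sup>2 * normal_density y \<sigma> x) (at y within A)"
  unfolding normal_density_def using assms
  by (auto intro!: derivative_eq_intros simp: power2_eq_square divide_simps) (simp add: algebra_simps)

lemma normal_density_abs_moment_shift:
  assumes "\<sigma> > 0"
  shows "integrable lborel (\<lambda>x. (x - y) / \<sigma>\<^sup>2 * normal_density y \<sigma> x)"
    and "(LINT x|lborel. \<bar>(x - y) / \<sigma>\<^sup>2 * normal_density y \<sigma> x\<bar>) =
         (LINT x|lborel. \<bar>x / \<sigma>\<^sup>2 * normal_density 0 \<sigma> x\<bar>)"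
proof -
  have "integrable lborel (\<lambda>x. inverse (\<sigma>\<^sup>2) * (normal_density y \<sigma> x * (x - y) ^ 1))"
    using assms by (intro integrable_mult_right integrable_normal_moment)
  then show "integrable lborel (\<lambda>x. (x - y) / \<sigma>\<^sup>2 * normal_density y \<sigma> x)"
    by (simp add: field_simps)
  show "(LINT x|lborel. \<bar>(x - y) / \<sigma>\<^sup>2 * normal_density y \<sigma> x\<bar>) =
         (LINT x|lborel. \<bar>x / \<sigma>\<^sup>2 * normal_density 0 \<sigma> x\<bar>)"
    by (subst lborel_integral_real_affine[where c=1 and t=y]) (auto simp: normal_density_def)
qed

lemma integral_gaussian_derivative_convolution:
  fixes u :: "real \<Rightarrow> real"
  assumes u: "continuous_on UNIV u" "bounded (range u)" and \<sigma>: "\<sigma> > 0" and "a \<le> b"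
  shows "(LINT y|lborel. indicator {a..b} y * (LINT x|lborel. u x * ((x - y) / \<sigma>\<^sup>2 * normal_density y \<sigma> x))) =
    (LINT x|lborel. u x * normal_density b \<sigma> x) - (LINT x|lborel. u x * normal_density a \<sigma> x)"
proof -
  define K where "K = (\<lambda>y x. (x - y) / \<sigma>\<^sup>2 * normal_density y \<sigma> x)"
  define C where "C = (LINT x|lborel. \<bar>x / \<sigma>\<^sup>2 * normal_density 0 \<sigma> x\<bar>)"
  obtain M where M: "\<And>x. \<bar>u x\<bar> \<le> M" using u(2) by (auto simp: bounded_iff)
  have M0: "M \<ge> 0" using M[of 0] by linarith
  have [measurable]: "u \<in> borel_measurable borel" using u(1) by (rule borel_measurable_continuous_onI)
  have Km [measurable]: "(\<lambda>(y, x). K y x) \<in> borel_measurable (borel \<Otimes>\<^sub>M borel)"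
    unfolding K_def normal_density_def by measurable
  have Ki: "integrable lborel (K y)" for y
    unfolding K_def by (rule normal_density_abs_moment_shift[OF \<sigma>])
  have uKi: "integrable lborel (\<lambda>x. u x * K y x)" for y
    by (rule Bochner_Integration.integrable_bound[OF integrable_mult_right[OF integrable_norm[OF Ki[of y]], of M]])
       (auto simp: abs_mult M0 intro!: AE_I2 mult_right_mono M)
  have uKb: "(LINT x|lborel. norm (u x * K y x)) \<le> M * C" for y
  proof -
    have "(LINT x|lborel. norm (u x * K y x)) \<le> (LINT x|lborel. M * \<bar>K y x\<bar>)"
      using integrable_norm[OF uKi[of y]] Ki[of y]
      by (rule_tac integral_mono) (auto simp: abs_mult intro!: mult_right_mono M)
    also have "\<dots> = M * C"
      by (simp only: integral_mult_right_zero K_def C_def normal_density_abs_moment_shift(2)[OF \<sigma>, of y])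
    finally show ?thesis .
  qed
  have int: "integrable (lborel \<Otimes>\<^sub>M lborel) (\<lambda>(y, x). indicator {a..b} y * (u x * K y x))"
  proof (rule lborel_pair.Fubini_integrable)
    show "(\<lambda>(y, x). indicator {a..b} y * (u x * K y x)) \<in> borel_measurable (lborel \<Otimes>\<^sub>M lborel)"
      by measurable
    have "integrable lborel (\<lambda>y. M * C * indicator {a..b} y)"
      by (intro integrable_mult_right integrable_real_indicator) (auto simp: emeasure_lborel_Icc_eq)
    then have "integrable lborel (\<lambda>y. indicator {a..b} y * (LINT x|lborel. norm (u x * K y x)))"
    proof (rule Bochner_Integration.integrable_bound)
      have "0 \<le> (LINT x|lborel. norm (u x * K y x))" for y by (rule integral_nonneg_AE) simp
      then have "norm (indicator {a..b} y * (LINT x|lborel. norm (u x * K y x))) \<le> norm (M * C * indicator {a..b} y)" for y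
        using order_trans[OF uKb[of y] abs_ge_self] by (simp add: indicator_def)
      then show "AE y in lborel. norm (indicator {a..b} y * (LINT x|lborel. norm (u x * K y x))) \<le> norm (M * C * indicator {a..b} y)"
        by simp
    qed measurable
    then show "integrable lborel (\<lambda>y. LINT x|lborel. norm (case (y, x) of (y, x) \<Rightarrow> indicator {a..b} y * (u x * K y x)))"
      by (simp add: abs_mult mult.assoc)
    show "AE y in lborel. integrable lborel (\<lambda>x. case (y, x) of (y, x) \<Rightarrow> indicator {a..b} y * (u x * K y x))"
      using uKi by simp
  qed
  have "(LINT y|lborel. indicator {a..b} y * (LINT x|lborel. u x * K y x)) =
    (LINT y|lborel. LINT x|lborel. indicator {a..b} y * (u x * K y x))" by simp
  also have "\<dots> = (LINT x|lborel. LINT y|lborel. indicator {a..b} y * (u x * K y x))"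
    by (rule lborel_pair.Fubini_integral[OF int, symmetric])
  also have "\<dots> = (LINT x|lborel. u x * (LINT y|lborel. indicator {a..b} y *\<^sub>R K y x))"
    by (simp add: mult.left_commute)
  also have "\<dots> = (LINT x|lborel. u x * (normal_density b \<sigma> x - normal_density a \<sigma> x))"
  proof -
    have "(LINT y|lborel. indicator {a..b} y *\<^sub>R K y x) = normal_density b \<sigma> x - normal_density a \<sigma> x" for x
    proof (rule integral_FTC_atLeastAtMost[OF \<open>a \<le> b\<close>])
      show "((\<lambda>y. normal_density y \<sigma> x) has_vector_derivative K y x) (at y within {a..b})" for y
        using normal_density_mean_derivative[OF \<sigma>, of x y "{a..b}"]
        by (simp add: K_def has_real_derivative_iff_has_vector_derivative)
      show "continuous_on {a..b} (\<lambda>y. K y x)"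
        unfolding K_def normal_density_def using \<sigma> by (intro continuous_intros) auto
    qed
    then show ?thesis by simp
  qed
  also have "\<dots> = (LINT x|lborel. u x * normal_density b \<sigma> x) - (LINT x|lborel. u x * normal_density a \<sigma> x)"
    using integrable_normal_density_mult[OF u \<sigma>] by (simp add: right_diff_distrib)
  finally show ?thesis by (simp add: K_def)
qed

lemma inverse_fourier_bound:
  "cmod (inverse_fourier F x) \<le> (LINT \<xi>|lborel. cmod (F \<xi>)) / (2 * pi)"
proof -
  have "cmod (LINT \<xi>|lborel. F \<xi> * cis (x * \<xi>)) \<le> (LINT \<xi>|lborel. cmod (F \<xi> * cis (x * \<xi>)))"
    by (rule integral_norm_bound)
  then show ?thesis by (simp add: inverse_fourier_def norm_divide norm_mult divide_right_mono)
qed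

lemma borel_measurable_cis_mult [measurable]: "(\<lambda>\<xi>. cis (x * \<xi>)) \<in> borel_measurable borel"
  by (intro borel_measurable_continuous_onI continuous_intros)

lemma continuous_inverse_fourier:
  assumes F: "integrable lborel F"
  shows "continuous_on A (inverse_fourier F)"
proof (intro continuous_at_imp_continuous_on ballI)
  fix x :: real
  have [measurable]: "F \<in> borel_measurable borel" using F by auto
  have "isCont (\<lambda>x. LINT \<xi>|lborel. F \<xi> * cis (x * \<xi>)) x"
    unfolding continuous_at_sequentially comp_def
  proof (intro allI impI)
    fix X assume X: "X \<longlonglongrightarrow> x"
    show "(\<lambda>n. LINT \<xi>|lborel. F \<xi> * cis (X n * \<xi>)) \<longlonglongrightarrow> (LINT \<xi>|lborel. F \<xi> * cis (x * \<xi>))"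
      by (rule integral_dominated_convergence[where w="\<lambda>\<xi>. cmod (F \<xi>)"])
         (use F in \<open>auto simp: norm_mult intro!: tendsto_intros X isCont_tendsto_compose[where g=cis]\<close>)
  qed
  then show "isCont (inverse_fourier F) x"
    unfolding inverse_fourier_def[abs_def] by (intro continuous_intros) auto
qed

lemma inverse_fourier_gaussian_tendsto:
  assumes F: "integrable lborel F" and \<sigma>: "\<sigma> \<longlonglongrightarrow> 0"
  shows "(\<lambda>n. inverse_fourier (\<lambda>\<xi>. F \<xi> * complex_of_real (exp (- ((\<sigma> n)\<^sup>2 * \<xi>\<^sup>2 / 2)))) x) \<longlonglongrightarrow> inverse_fourier F x"
  unfolding inverse_fourier_def
proof (intro tendsto_divide tendsto_const integral_dominated_convergence[where w="\<lambda>\<xi>. cmod (F \<xi>)"])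
  have [measurable]: "F \<in> borel_measurable borel" using F by auto
  show "AE \<xi> in lborel. (\<lambda>n. F \<xi> * complex_of_real (exp (- ((\<sigma> n)\<^sup>2 * \<xi>\<^sup>2 / 2))) * cis (x * \<xi>)) \<longlonglongrightarrow> F \<xi> * cis (x * \<xi>)"
  proof (intro AE_I2)
    fix \<xi>
    have "(\<lambda>n. F \<xi> * complex_of_real (exp (- ((\<sigma> n)\<^sup>2 * \<xi>\<^sup>2 / 2))) * cis (x * \<xi>)) \<longlonglongrightarrow>
       F \<xi> * complex_of_real (exp (- (0\<^sup>2 * \<xi>\<^sup>2 / 2))) * cis (x * \<xi>)"
      by (intro tendsto_intros \<sigma>) auto
    then show "(\<lambda>n. F \<xi> * complex_of_real (exp (- ((\<sigma> n)\<^sup>2 * \<xi>\<^sup>2 / 2))) * cis (x * \<xi>)) \<longlonglongrightarrow> F \<xi> * cis (x * \<xi>)"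
      by simp
  qed
  show "AE \<xi> in lborel. cmod (F \<xi> * complex_of_real (exp (- ((\<sigma> n)\<^sup>2 * \<xi>\<^sup>2 / 2))) * cis (x * \<xi>)) \<le> cmod (F \<xi>)" for n
    by (intro AE_I2) (simp add: norm_mult mult_left_le)
  show "integrable lborel (\<lambda>\<xi>. cmod (F \<xi>))" using F by simp
qed (use F in \<open>auto intro!: borel_measurable_times\<close>)

text \<open>
  Tests against the Gaussians \<open>modulated_gaussian y (\<sigma>\<^sup>2)\<close>, integrates over \<open>y \<in> {a..b}\<close> and
  lets \<open>\<sigma>\<close> tend to \<open>0\<close>; this replaces Fourier inversion for general Schwartz functions.
\<close>

lemma multiplier_transform_increment:
  fixes u :: "real \<Rightarrow> real"
  assumes u: "continuous_on UNIV u" "bounded (range u)" and F: "integrable lborel F"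
    and m: "multiplier_transform ddx_symbol u F" and "a \<le> b"
  shows "u b - u a = (LINT y|lborel. indicator {a..b} y * Re (inverse_fourier F y))"
proof -
  define \<sigma> where "\<sigma> = (\<lambda>n. inverse (real (Suc n)))"
  have \<sigma>: "\<sigma> n > 0" "\<sigma> \<longlonglongrightarrow> 0" for n
    unfolding \<sigma>_def using LIMSEQ_inverse_real_of_nat by (auto)
  define G where "G = (\<lambda>n \<xi>. F \<xi> * complex_of_real (exp (- ((\<sigma> n)\<^sup>2 * \<xi>\<^sup>2 / 2))))"
  have [measurable]: "F \<in> borel_measurable borel" using F by auto
  have Gi: "integrable lborel (G n)" for n
    unfolding G_def
    by (rule Bochner_Integration.integrable_bound[OF F]) (auto simp: norm_mult mult_left_le)
  have Gc [measurable]: "inverse_fourier (G n) \<in> borel_measurable borel" for n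
    by (intro borel_measurable_continuous_onI continuous_inverse_fourier Gi)
  have Fc [measurable]: "inverse_fourier F \<in> borel_measurable borel"
    by (intro borel_measurable_continuous_onI continuous_inverse_fourier F)
  define B where "B = (LINT \<xi>|lborel. cmod (F \<xi>)) / (2 * pi)"
  have Gb: "cmod (inverse_fourier (G n) y) \<le> B" for n y
  proof -
    have "(LINT \<xi>|lborel. cmod (G n \<xi>)) \<le> (LINT \<xi>|lborel. cmod (F \<xi>))"
      using integrable_norm[OF F] integrable_norm[OF Gi] by (rule_tac integral_mono) (auto simp: G_def norm_mult mult_left_le)
    then show ?thesis
      using inverse_fourier_bound[of "G n" y] by (simp add: B_def divide_simps)
  qed
  have "(LINT y|lborel. indicator {a..b} y * Re (inverse_fourier (G n) y)) =
    (LINT x|lborel. u x * normal_density b (\<sigma> n) x) - (LINT x|lborel. u x * normal_density a (\<sigma> n) x)" for n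
    unfolding integral_gaussian_derivative_convolution[OF u \<sigma>(1) \<open>a \<le> b\<close>, symmetric]
      G_def multiplier_transform_gaussian[OF m \<sigma>(1), symmetric] by simp
  moreover have "(\<lambda>n. LINT y|lborel. indicator {a..b} y * Re (inverse_fourier (G n) y)) \<longlonglongrightarrow>
     (LINT y|lborel. indicator {a..b} y * Re (inverse_fourier F y))"
  proof (rule integral_dominated_convergence[where w="\<lambda>y. B * indicator {a..b} y"])
    show "AE y in lborel. (\<lambda>n. indicator {a..b} y * Re (inverse_fourier (G n) y)) \<longlonglongrightarrow> indicator {a..b} y * Re (inverse_fourier F y)"
      unfolding G_def by (intro AE_I2 tendsto_intros inverse_fourier_gaussian_tendsto F \<sigma>)
    show "AE y in lborel. norm (indicator {a..b} y * Re (inverse_fourier (G n) y)) \<le> B * indicator {a..b} y" for n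
      using Gb by (intro AE_I2) (auto simp: indicator_def intro: order_trans[OF abs_Re_le_cmod])
    show "integrable lborel (\<lambda>y. B * indicator {a..b} y)"
      by (intro integrable_mult_right integrable_real_indicator) (auto simp: emeasure_lborel_Icc_eq)
  qed auto
  moreover have "(\<lambda>n. (LINT x|lborel. u x * normal_density b (\<sigma> n) x) - (LINT x|lborel. u x * normal_density a (\<sigma> n) x))
     \<longlonglongrightarrow> u b - u a"
    by (intro tendsto_diff normal_density_convolution_tendsto u \<sigma>)
  ultimately show ?thesis by (simp add: LIMSEQ_unique)
qed

lemma multiplier_transform_derivative:
  fixes u :: "real \<Rightarrow> real"
  assumes u: "continuous_on UNIV u" "bounded (range u)" and F: "integrable lborel F"
    and m: "multiplier_transform ddx_symbol u F"
  shows "(u has_real_derivative Re (inverse_fourier F x)) (at x)"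
proof -
  let ?f = "\<lambda>y. Re (inverse_fourier F y)"
  have c: "continuous_on A ?f" for A by (intro continuous_intros continuous_inverse_fourier F)
  have "u y = u (x - 1) + integral {x - 1..y} ?f" if "y \<in> {x-1..x+1}" for y
  proof -
    have "set_integrable lborel {x - 1..y} ?f" by (rule borel_integrable_atLeastAtMost'[OF c])
    then show ?thesis
      using multiplier_transform_increment[OF u F m, of "x-1" y] that
      by (simp add: set_borel_integral_eq_integral(2)[symmetric] set_lebesgue_integral_def)
  qed
  note eq = this
  have "(u has_real_derivative ?f x) (at x within {x-1..x+1})"
  proof (rule has_field_derivative_transform_within[where d=1])
    show "((\<lambda>y. u (x - 1) + integral {x - 1..y} ?f) has_real_derivative ?f x) (at x within {x-1..x+1})"
      using integral_has_real_derivative[OF c, of x "x-1" "x+1"] by (auto intro!: derivative_eq_intros)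
    show "u (x - 1) + integral {x - 1..y} ?f = u y" if "y \<in> {x-1..x+1}" for y
      by (rule eq[OF that, symmetric])
  qed auto
  moreover have "at x within {x-1..x+1} = at x" by (rule at_within_Icc_at) auto
  ultimately show ?thesis by simp
qed

lemma sobolev_weight_ge:
  assumes "s \<ge> 2"
  shows "1 + \<xi>\<^sup>2 \<le> sobolev_weight (s - 1) \<xi>"
  using powr_mono[of 1 "s - 1" "1 + \<xi>\<^sup>2"] assms by (simp add: sobolev_weight_def)

lemma weighted_transform_integrable:
  assumes "s \<ge> 2" and F: "weighted_transform (sobolev_weight (s - 1)) m u F" and "l > 0"
  shows "integrable lborel F"
    and "(LINT \<xi>|lborel. cmod (F \<xi>)) \<le>
      (l * (LINT \<xi>|lborel. sobolev_weight (s - 1) \<xi> * (cmod (F \<xi>))\<^sup>2) + pi / l) / 2"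
proof -
  let ?w = "sobolev_weight (s - 1)"
  let ?h = "\<lambda>\<xi>. (l * (?w \<xi> * (cmod (F \<xi>))\<^sup>2) + inverse (1 + \<xi>\<^sup>2) / l) / 2"
  have [measurable]: "F \<in> borel_measurable borel" and Fi: "integrable lborel (\<lambda>\<xi>. ?w \<xi> * (cmod (F \<xi>))\<^sup>2)"
    using F by (auto simp: weighted_transform_def)
  have h: "integrable lborel ?h"
    using Fi integrable_inverse_1_plus_square' by auto
  have le: "cmod (F \<xi>) \<le> ?h \<xi>" for \<xi>
  proof -
    define q where "q = 1 + \<xi>\<^sup>2"
    have q: "q > 0" by (simp add: q_def add_pos_nonneg)
    have "0 \<le> (l * q * cmod (F \<xi>) - 1)\<^sup>2 / (l * q)" using q assms(3) by simp
    also have "\<dots> = l * (q * (cmod (F \<xi>))\<^sup>2) + inverse q / l - 2 * cmod (F \<xi>)"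
      using q assms(3) by (simp add: power2_eq_square divide_simps) (simp add: algebra_simps)
    also have "q * (cmod (F \<xi>))\<^sup>2 \<le> ?w \<xi> * (cmod (F \<xi>))\<^sup>2"
      unfolding q_def by (intro mult_right_mono sobolev_weight_ge assms) auto
    finally show ?thesis using assms(3) by (simp add: q_def)
  qed
  show Fint: "integrable lborel F"
    by (rule Bochner_Integration.integrable_bound[OF h]) (measurable, use le in \<open>intro AE_I2, metis abs_ge_self order_trans real_norm_def\<close>)
  have "(LINT \<xi>|lborel. cmod (F \<xi>)) \<le> (LINT \<xi>|lborel. ?h \<xi>)"
    by (rule integral_mono[OF integrable_norm[OF Fint] h le])
  also have "\<dots> = (l * (LINT \<xi>|lborel. ?w \<xi> * (cmod (F \<xi>))\<^sup>2) + pi / l) / 2"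
    using Fi integrable_inverse_1_plus_square' by (simp add: integral_inverse_1_plus_square)
  finally show "(LINT \<xi>|lborel. cmod (F \<xi>)) \<le> (l * (LINT \<xi>|lborel. ?w \<xi> * (cmod (F \<xi>))\<^sup>2) + pi / l) / 2" .
qed

lemma E_space_derivative:
  assumes "s \<ge> 2" "u \<in> E_space s"
  shows "(u has_real_derivative deriv u x) (at x)" "continuous_on A (deriv u)" "bounded (range (deriv u))"
proof -
  obtain F where u: "continuous_on UNIV u" "bounded (range u)"
    and F: "weighted_transform (sobolev_weight (s - 1)) ddx_symbol u F"
    using assms(2) by (auto simp: E_space_def)
  have Fi: "integrable lborel F" using weighted_transform_integrable[OF assms(1) F, of 1] by simp
  have d: "(u has_real_derivative Re (inverse_fourier F x)) (at x)" for x
    using multiplier_transform_derivative[OF u Fi] F by (simp add: weighted_transform_def)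
  then have eq: "deriv u = (\<lambda>x. Re (inverse_fourier F x))"
    by (auto intro: DERIV_imp_deriv)
  show "(u has_real_derivative deriv u x) (at x)" using d by (simp add: eq)
  show "continuous_on A (deriv u)"
    unfolding eq by (intro continuous_intros continuous_inverse_fourier Fi)
  show "bounded (range (deriv u))"
    unfolding eq
    by (intro boundedI[where B="(LINT \<xi>|lborel. cmod (F \<xi>)) / (2 * pi)"])
       (auto intro!: order_trans[OF abs_Re_le_cmod] inverse_fourier_bound)
qed

lemma abs_le_sup_norm: "bounded (range u) \<Longrightarrow> \<bar>u x\<bar> \<le> sup_norm u"
  unfolding sup_norm_def by (rule cSUP_upper) (auto simp: bounded_iff bdd_above_def)

lemma weighted_norm_nonneg: "(\<And>\<xi>. 0 \<le> w \<xi>) \<Longrightarrow> 0 \<le> weighted_norm w m u"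
  unfolding weighted_norm_def by (intro real_sqrt_ge_zero mult_nonneg_nonneg integral_nonneg_AE) auto

lemma E_norm_controls_C1:
  assumes "s \<ge> 2" "u \<in> E_space s" "E_norm s u < e"
  shows "\<bar>u x\<bar> \<le> e" "\<bar>deriv u x\<bar> \<le> e"
proof -
  let ?w = "sobolev_weight (s - 1)"
  define F where "F = (SOME F. weighted_transform ?w ddx_symbol u F)"
  have u: "continuous_on UNIV u" "bounded (range u)" and ex: "\<exists>F. weighted_transform ?w ddx_symbol u F"
    using assms(2) by (auto simp: E_space_def)
  have F: "weighted_transform ?w ddx_symbol u F"
    unfolding F_def by (rule someI_ex[OF ex])
  have n: "E_norm s u = sup_norm u + weighted_norm ?w ddx_symbol u" by (simp add: E_norm_def)
  have n0: "0 \<le> sup_norm u" using abs_le_sup_norm[OF u(2), of 0] by linarith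
  have n1: "0 \<le> weighted_norm ?w ddx_symbol u" by (intro weighted_norm_nonneg) (simp add: sobolev_weight_def)
  show "\<bar>u x\<bar> \<le> e" using abs_le_sup_norm[OF u(2), of x] n n1 assms(3) by linarith
  have "e > 0" using n n0 n1 assms(3) by linarith
  define I where "I = (LINT \<xi>|lborel. ?w \<xi> * (cmod (F \<xi>))\<^sup>2)"
  have I0: "0 \<le> I" unfolding I_def by (intro integral_nonneg_AE) (auto simp: sobolev_weight_def)
  have "sqrt (1 / (2 * pi) * I) < e"
    using n n0 assms(3) by (simp add: weighted_norm_def F_def[symmetric] I_def[symmetric])
  then have "(sqrt (1 / (2 * pi) * I))\<^sup>2 \<le> e\<^sup>2"
    using I0 by (intro power_mono) auto
  then have I: "I \<le> 2 * pi * e\<^sup>2" using I0 by (simp add: field_simps)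
  have Fi: "integrable lborel F" using weighted_transform_integrable[OF assms(1) F, of 1] by simp
  have "(LINT \<xi>|lborel. cmod (F \<xi>)) \<le> (1 / e * I + pi / (1 / e)) / 2"
    unfolding I_def using \<open>e > 0\<close> by (intro weighted_transform_integrable[OF assms(1) F]) simp
  also have "\<dots> \<le> (1 / e * (2 * pi * e\<^sup>2) + pi / (1 / e)) / 2"
    using I \<open>e > 0\<close> by (intro divide_right_mono add_right_mono mult_left_mono) auto
  also have "\<dots> \<le> e * (2 * pi)" using \<open>e > 0\<close> by (simp add: power2_eq_square)
  finally have L: "(LINT \<xi>|lborel. cmod (F \<xi>)) / (2 * pi) \<le> e" by (simp add: pos_divide_le_eq)
  have "(u has_real_derivative Re (inverse_fourier F x)) (at x)"
    using multiplier_transform_derivative[OF u Fi] F by (simp add: weighted_transform_def)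
  then have "deriv u x = Re (inverse_fourier F x)" by (rule DERIV_imp_deriv)
  then show "\<bar>deriv u x\<bar> \<le> e"
    using abs_Re_le_cmod[of "inverse_fourier F x"] inverse_fourier_bound[of F x] L by linarith
qed

lemma schwartz_bounded: "schwartz \<phi> \<Longrightarrow> continuous_on A \<phi> \<and> bounded (range \<phi>)"
proof -
  assume "schwartz \<phi>"
  then obtain D where D: "D 0 = \<phi>" "schwartz_derivs D" by (auto simp: schwartz_iff_derivs)
  then have "bounded (range (\<lambda>x. x ^ 0 *\<^sub>R D 0 x))" unfolding schwartz_derivs_def by blast
  then show ?thesis using schwartz_derivs_continuous[OF D(2), of A 0] D(1) by simp
qed

lemma integrable_mult_schwartz:
  assumes "schwartz \<phi>" "integrable lborel F"
  shows "integrable lborel (\<lambda>\<xi>. F \<xi> * \<phi> \<xi>)"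
proof -
  obtain B where B: "\<And>x. cmod (\<phi> x) \<le> B" using schwartz_bounded[OF assms(1)] by (auto simp: bounded_iff)
  then have B0: "0 \<le> B" using norm_ge_zero order_trans by blast
  have [measurable]: "\<phi> \<in> borel_measurable borel"
    using schwartz_bounded[OF assms(1)] by (intro borel_measurable_continuous_onI) auto
  show ?thesis
    by (rule Bochner_Integration.integrable_bound[OF integrable_mult_right[OF integrable_norm[OF assms(2)], of B]])
       (use assms(2) B B0 in \<open>auto simp: norm_mult mult.commute[of B] intro!: mult_left_mono\<close>)
qed

lemma E_space_diff:
  assumes s: "s \<ge> 2" and "u \<in> E_space s" "v \<in> E_space s"
  shows "(\<lambda>x. u x - v x) \<in> E_space s"
proof -
  let ?w = "sobolev_weight (s - 1)"
  obtain F G where u: "continuous_on UNIV u" "bounded (range u)" and F: "weighted_transform ?w ddx_symbol u F"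
    and v: "continuous_on UNIV v" "bounded (range v)" and G: "weighted_transform ?w ddx_symbol v G"
    using assms by (auto simp: E_space_def)
  have Fi: "integrable lborel F" and Gi: "integrable lborel G"
    using weighted_transform_integrable[OF s F, of 1] weighted_transform_integrable[OF s G, of 1] by auto
  have [measurable]: "F \<in> borel_measurable borel" "G \<in> borel_measurable borel" using Fi Gi by auto
  have [measurable]: "?w \<in> borel_measurable borel"
    unfolding sobolev_weight_def[abs_def] by measurable
  have w0: "0 \<le> ?w \<xi>" for \<xi> by (simp add: sobolev_weight_def)
  have "integrable lborel (\<lambda>\<xi>. 2 * (?w \<xi> * (cmod (F \<xi>))\<^sup>2) + 2 * (?w \<xi> * (cmod (G \<xi>))\<^sup>2))"
    using F G by (auto simp: weighted_transform_def)
  then have "integrable lborel (\<lambda>\<xi>. ?w \<xi> * (cmod (F \<xi> - G \<xi>))\<^sup>2)"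
  proof (rule Bochner_Integration.integrable_bound)
    show "AE \<xi> in lborel. norm (?w \<xi> * (cmod (F \<xi> - G \<xi>))\<^sup>2)
       \<le> norm (2 * (?w \<xi> * (cmod (F \<xi>))\<^sup>2) + 2 * (?w \<xi> * (cmod (G \<xi>))\<^sup>2))"
    proof (rule AE_I2)
      fix \<xi>
      have "(cmod (F \<xi> - G \<xi>))\<^sup>2 \<le> (cmod (F \<xi>) + cmod (G \<xi>))\<^sup>2"
        by (intro power_mono norm_triangle_ineq4) auto
      also have "\<dots> \<le> 2 * (cmod (F \<xi>))\<^sup>2 + 2 * (cmod (G \<xi>))\<^sup>2"
        using zero_le_power2[of "cmod (F \<xi>) - cmod (G \<xi>)"] by (simp add: power2_sum power2_diff)
      finally have "?w \<xi> * (cmod (F \<xi> - G \<xi>))\<^sup>2 \<le> ?w \<xi> * (2 * (cmod (F \<xi>))\<^sup>2 + 2 * (cmod (G \<xi>))\<^sup>2)"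
        by (intro mult_left_mono w0)
      then show "norm (?w \<xi> * (cmod (F \<xi> - G \<xi>))\<^sup>2)
       \<le> norm (2 * (?w \<xi> * (cmod (F \<xi>))\<^sup>2) + 2 * (?w \<xi> * (cmod (G \<xi>))\<^sup>2))"
        using w0[of \<xi>] by (simp add: algebra_simps)
    qed
  qed measurable
  moreover have "multiplier_transform ddx_symbol (\<lambda>x. u x - v x) (\<lambda>\<xi>. F \<xi> - G \<xi>)"
    unfolding multiplier_transform_def
  proof (intro allI impI)
    fix \<phi> assume \<phi>: "schwartz \<phi>"
    show "(LINT x|lborel. complex_of_real (u x - v x) * fourier (\<lambda>\<xi>. ddx_symbol \<xi> * \<phi> \<xi>) x)
        = (LINT \<xi>|lborel. (F \<xi> - G \<xi>) * \<phi> \<xi>)"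
      using F G \<phi> integrable_ddx_pairing[OF \<phi> u] integrable_ddx_pairing[OF \<phi> v]
        integrable_mult_schwartz[OF \<phi> Fi] integrable_mult_schwartz[OF \<phi> Gi]
      by (simp add: weighted_transform_def multiplier_transform_def left_diff_distrib)
  qed
  ultimately have "weighted_transform ?w ddx_symbol (\<lambda>x. u x - v x) (\<lambda>\<xi>. F \<xi> - G \<xi>)"
    by (simp add: weighted_transform_def)
  moreover have "bounded (range (\<lambda>x. u x - v x))" using u v by (intro bounded_minus_comp) auto
  moreover have "continuous_on UNIV (\<lambda>x. u x - v x)" using u v by (intro continuous_intros)
  ultimately show ?thesis by (auto simp: E_space_def)
qed

section \<open>Characteristics\<close>

lemma uniform_family_bounded:
  fixes f :: "real \<Rightarrow> real \<Rightarrow> real"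
  assumes "compact S"
    and b: "\<And>t. t \<in> S \<Longrightarrow> continuous_on UNIV (f t) \<and> bounded (range (f t))"
    and unif: "\<And>t e. t \<in> S \<Longrightarrow> e > 0 \<Longrightarrow> \<exists>d>0. \<forall>r\<in>S. \<bar>r - t\<bar> < d \<longrightarrow> (\<forall>x. \<bar>f r x - f t x\<bar> \<le> e)"
  obtains B where "B > 0" "\<And>t x. t \<in> S \<Longrightarrow> \<bar>f t x\<bar> \<le> B"
proof -
  have ap: "apply_bcontfun (Bcontfun (f t)) = f t" if "t \<in> S" for t
    using b[OF that] by (intro Bcontfun_inverse) (simp add: bcontfun_def)
  have "continuous_on S (\<lambda>t. Bcontfun (f t))"
    unfolding continuous_on_iff
  proof (intro ballI allI impI)
    fix t and e :: real assume t: "t \<in> S" and e: "0 < e"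
    then obtain d where d: "d > 0" "\<And>r x. r \<in> S \<Longrightarrow> \<bar>r - t\<bar> < d \<Longrightarrow> \<bar>f r x - f t x\<bar> \<le> e / 2"
      using unif[of t "e/2"] by auto
    have "dist (Bcontfun (f r)) (Bcontfun (f t)) < e" if "r \<in> S" "dist r t < d" for r
    proof -
      have "dist (Bcontfun (f r)) (Bcontfun (f t)) \<le> e / 2"
        by (rule dist_bound) (use d(2)[of r] that ap t in \<open>auto simp: dist_real_def\<close>)
      then show ?thesis using e by linarith
    qed
    then show "\<exists>d>0. \<forall>x'\<in>S. dist x' t < d \<longrightarrow> dist (Bcontfun (f x')) (Bcontfun (f t)) < e"
      using d(1) by blast
  qed
  then have "bounded ((\<lambda>t. Bcontfun (f t)) ` S)"
    using assms(1) compact_continuous_image compact_imp_bounded by blast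
  then obtain B where B: "\<And>t. t \<in> S \<Longrightarrow> norm (Bcontfun (f t)) \<le> B"
    by (auto simp: bounded_iff)
  have "\<bar>f t x\<bar> \<le> \<bar>B\<bar> + 1" if "t \<in> S" for t x
    using norm_bounded[of "Bcontfun (f t)" x] B[OF that] ap[OF that] by simp
  then show ?thesis using that[of "\<bar>B\<bar> + 1"] by simp
qed

lemma uniform_family_continuous:
  fixes f :: "real \<Rightarrow> real \<Rightarrow> real"
  assumes c: "\<And>t. t \<in> S \<Longrightarrow> continuous_on UNIV (f t)"
    and unif: "\<And>t e. t \<in> S \<Longrightarrow> e > 0 \<Longrightarrow> \<exists>d>0. \<forall>r\<in>S. \<bar>r - t\<bar> < d \<longrightarrow> (\<forall>x. \<bar>f r x - f t x\<bar> \<le> e)"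
  shows "continuous_on (S \<times> UNIV) (\<lambda>(t, x). f t x)"
  unfolding continuous_on_iff
proof (clarify)
  fix t x and e :: real assume t: "t \<in> S" and e: "0 < e"
  obtain d where d: "d > 0" "\<And>r x. r \<in> S \<Longrightarrow> \<bar>r - t\<bar> < d \<Longrightarrow> \<bar>f r x - f t x\<bar> \<le> e / 2"
    using unif[of t "e/2"] t e by auto
  obtain d' where d': "d' > 0" "\<And>y. \<bar>y - x\<bar> < d' \<Longrightarrow> \<bar>f t y - f t x\<bar> < e / 2"
    using c[OF t] e unfolding continuous_on_iff dist_real_def by (metis UNIV_I half_gt_zero)
  have "\<bar>f r y - f t x\<bar> < e" if "r \<in> S" "dist (r, y) (t, x) < min d d'" for r y
  proof -
    have "\<bar>r - t\<bar> < d" "\<bar>y - x\<bar> < d'"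
      using that(2) dist_fst_le[of "(r, y)" "(t, x)"] dist_snd_le[of "(r, y)" "(t, x)"]
      by (auto simp: dist_real_def)
    then show ?thesis using d(2)[OF that(1), of y] d'(2)[of y] by linarith
  qed
  then show "\<exists>d>0. \<forall>x'\<in>S \<times> UNIV. dist x' (t, x) < d \<longrightarrow>
      dist (case x' of (t, x) \<Rightarrow> f t x) (f t x) < e"
    using d(1) d'(1) by (intro exI[of _ "min d d'"]) (auto simp: dist_real_def)
qed

text \<open>
  Picard iteration for the unknown \<open>z t = exp (- 2 * K * t) * q t\<close>, for which the Picard operator is
  a contraction on all of \<open>{0..T}\<close>, however large \<open>T\<close> is.
\<close>

lemma picard_lindelof_global:
  fixes U :: "real \<Rightarrow> real \<Rightarrow> real"
  assumes "T \<ge> 0" "K > 0"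
    and cont: "continuous_on ({0..T} \<times> UNIV) (\<lambda>(t, x). U t x)"
    and lip: "\<And>t x y. t \<in> {0..T} \<Longrightarrow> \<bar>U t x - U t y\<bar> \<le> K * \<bar>x - y\<bar>"
  obtains q where "q 0 = x0" "\<And>t. t \<in> {0..T} \<Longrightarrow> (q has_real_derivative U t (q t)) (at t within {0..T})"
proof -
  define L where "L = 2 * K"
  have L: "L > 0" using assms by (simp add: L_def)
  define c where "c = (\<lambda>t. max 0 (min T t))"
  have c: "c t \<in> {0..T}" "t \<in> {0..T} \<Longrightarrow> c t = t" for t
    using \<open>T \<ge> 0\<close> by (auto simp: c_def)
  have cc: "continuous_on A c" for A unfolding c_def by (intro continuous_intros)
  define G where "G = (\<lambda>(z :: real \<Rightarrow>\<^sub>C real) \<tau>. U \<tau> (exp (L * \<tau>) * z \<tau>))"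
  have Gc: "continuous_on {0..T} (G z)" for z
  proof -
    have "continuous_on {0..T} (\<lambda>\<tau>. (\<lambda>(t, x). U t x) (\<tau>, exp (L * \<tau>) * apply_bcontfun z \<tau>))"
      by (rule continuous_on_compose2[OF cont]) (auto intro!: continuous_intros)
    then show ?thesis by (simp add: G_def)
  qed
  have Gi: "G z integrable_on {0..t}" if "t \<in> {0..T}" for z t
    using that by (intro integrable_continuous_interval continuous_on_subset[OF Gc]) auto
  define H where "H = (\<lambda>z t. exp (- L * t) * (x0 + integral {0..t} (G z)))"
  have Hc: "continuous_on {0..T} (H z)" for z
    unfolding H_def by (intro continuous_intros indefinite_integral_continuous_1 Gi) (use \<open>T \<ge> 0\<close> in auto)
  have Hb: "(\<lambda>t. H z (c t)) \<in> bcontfun" for z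
  proof -
    have "continuous_on UNIV (\<lambda>t. H z (c t))"
      by (rule continuous_on_compose2[OF Hc cc]) (use c in auto)
    moreover have "range (\<lambda>t. H z (c t)) \<subseteq> H z ` {0..T}" using c by auto
    moreover have "bounded (H z ` {0..T})"
      by (intro compact_imp_bounded compact_continuous_image Hc) auto
    ultimately show ?thesis by (auto simp: bcontfun_def intro: bounded_subset)
  qed
  define \<Psi> where "\<Psi> = (\<lambda>z. Bcontfun (\<lambda>t. H z (c t)))"
  have \<Psi>: "apply_bcontfun (\<Psi> z) t = H z (c t)" for z t
    unfolding \<Psi>_def using Bcontfun_inverse[OF Hb] by simp
  have contr: "dist (\<Psi> z) (\<Psi> w) \<le> 1/2 * dist z w" for z w
  proof (rule dist_bound)
    fix t0
    define t where "t = c t0"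
    have t: "t \<in> {0..T}" unfolding t_def by (rule c)
    let ?d = "dist z w"
    have ei: "((\<lambda>\<tau>. K * exp (L * \<tau>) * ?d) has_integral K * ?d * exp (L * t) / L - K * ?d * exp (L * 0) / L) {0..t}"
      using t L
      by (intro fundamental_theorem_of_calculus)
         (auto intro!: derivative_eq_intros simp flip: has_real_derivative_iff_has_vector_derivative)
    have "\<bar>integral {0..t} (G z) - integral {0..t} (G w)\<bar> = norm (integral {0..t} (\<lambda>\<tau>. G z \<tau> - G w \<tau>))"
      using Gi[OF t] by (simp add: integral_diff)
    also have "\<dots> \<le> integral {0..t} (\<lambda>\<tau>. K * exp (L * \<tau>) * ?d)"
    proof (rule integral_norm_bound_integral)
      show "(\<lambda>\<tau>. G z \<tau> - G w \<tau>) integrable_on {0..t}" using Gi[OF t] by (intro integrable_diff)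
      show "(\<lambda>\<tau>. K * exp (L * \<tau>) * ?d) integrable_on {0..t}" using ei by blast
      fix \<tau> assume "\<tau> \<in> {0..t}"
      then have "\<bar>G z \<tau> - G w \<tau>\<bar> \<le> K * \<bar>exp (L * \<tau>) * z \<tau> - exp (L * \<tau>) * w \<tau>\<bar>"
        unfolding G_def using t by (intro lip) auto
      also have "\<dots> = K * exp (L * \<tau>) * dist (z \<tau>) (w \<tau>)"
        by (simp add: dist_real_def abs_mult flip: right_diff_distrib)
      also have "\<dots> \<le> K * exp (L * \<tau>) * ?d"
        using \<open>K > 0\<close> by (intro mult_left_mono dist_bounded) auto
      finally show "norm (G z \<tau> - G w \<tau>) \<le> K * exp (L * \<tau>) * ?d" by simp
    qed
    also have "\<dots> = K * ?d * exp (L * t) / L - K * ?d * exp (L * 0) / L"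
      using ei by (rule integral_unique)
    also have "\<dots> \<le> 1/2 * ?d * exp (L * t)"
      using \<open>K > 0\<close> by (simp add: L_def field_simps)
    finally have "exp (- L * t) * \<bar>integral {0..t} (G z) - integral {0..t} (G w)\<bar> \<le> exp (- L * t) * (1/2 * ?d * exp (L * t))"
      by (rule mult_left_mono) simp
    also have "\<dots> = 1/2 * ?d" by (simp add: exp_minus)
    finally have "\<bar>H z t - H w t\<bar> \<le> 1/2 * ?d"
      by (simp add: H_def abs_mult flip: right_diff_distrib)
    then show "dist (\<Psi> z t0) (\<Psi> w t0) \<le> 1/2 * dist z w"
      by (simp add: \<Psi> t_def dist_real_def)
  qed
  obtain z where z: "\<Psi> z = z"
    using banach_fix_type[of "1/2" \<Psi>] contr by auto
  define q where "q = (\<lambda>t. exp (L * t) * apply_bcontfun z t)"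
  have q: "q t = x0 + integral {0..t} (G z)" if "t \<in> {0..T}" for t
  proof -
    have "apply_bcontfun z t = H z t" using \<Psi>[of z t] z c(2)[OF that] by simp
    then show ?thesis by (simp add: q_def H_def exp_minus)
  qed
  have "(q has_real_derivative U t (q t)) (at t within {0..T})" if t: "t \<in> {0..T}" for t
  proof (rule has_field_derivative_transform_within[where d=1])
    show "((\<lambda>t. x0 + integral {0..t} (G z)) has_real_derivative U t (q t)) (at t within {0..T})"
      using integral_has_real_derivative[OF Gc t, of z]
      by (auto intro!: derivative_eq_intros simp: G_def q_def)
  qed (use q t in auto)
  moreover have "q 0 = x0" using q[of 0] \<open>T \<ge> 0\<close> by simp
  ultimately show ?thesis using that by blast
qed

lemma riccati_lifespan:
  fixes m :: "real \<Rightarrow> real"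
  assumes "T > 0" and m: "continuous_on {0..T} m" and "m 0 < 0"
    and le: "\<And>t. t \<in> {0..T} \<Longrightarrow> m t \<le> m 0 - integral {0..t} (\<lambda>\<tau>. (m \<tau>)\<^sup>2 / 2)"
  shows "T < 2 / - m 0"
proof -
  define N where "N = (\<lambda>t. - m 0 + integral {0..t} (\<lambda>\<tau>. (m \<tau>)\<^sup>2 / 2))"
  have c: "continuous_on {0..T} (\<lambda>\<tau>. (m \<tau>)\<^sup>2 / 2)" by (intro continuous_intros m) auto
  have Npos: "N t > 0" if "t \<in> {0..T}" for t
  proof -
    have "0 \<le> integral {0..t} (\<lambda>\<tau>. (m \<tau>)\<^sup>2 / 2)"
      using that by (intro integral_nonneg integrable_continuous_interval continuous_on_subset[OF c]) auto
    then show ?thesis using \<open>m 0 < 0\<close> by (simp add: N_def)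
  qed
  have Nd: "(N has_real_derivative (m t)\<^sup>2 / 2) (at t within {0..T})" if "t \<in> {0..T}" for t
    unfolding N_def
    by (rule DERIV_add[OF DERIV_const integral_has_real_derivative[OF c that], simplified add_0_left])
  have "1 / N T + T / 2 \<le> 1 / N 0 + 0 / 2"
  proof (rule DERIV_nonpos_imp_decreasing_open[of 0 T "\<lambda>t. 1 / N t + t / 2"])
    fix t assume t: "0 < t" "t < T"
    then have "at t within {0..T} = at t" by (intro at_within_Icc_at) auto
    then have "((\<lambda>t. 1 / N t + t / 2) has_real_derivative - ((m t)\<^sup>2 / 2) / (N t)\<^sup>2 + 1 / 2) (at t)"
      using Nd[of t] Npos[of t] t
      by (auto intro!: derivative_eq_intros simp: power2_eq_square)
    moreover have "(N t)\<^sup>2 \<le> (- m t)\<^sup>2"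
      using le[of t] Npos[of t] t by (intro power_mono) (auto simp: N_def)
    then have "- ((m t)\<^sup>2 / 2) / (N t)\<^sup>2 + 1 / 2 \<le> 0"
      using Npos[of t] t by (simp add: field_simps)
    ultimately show "\<exists>y. ((\<lambda>t. 1 / N t + t / 2) has_real_derivative y) (at t) \<and> y \<le> 0" by blast
  next
    have "continuous_on {0..T} N" by (rule DERIV_continuous_on) (rule Nd)
    then show "continuous_on {0..T} (\<lambda>t. 1 / N t + t / 2)"
      using Npos by (intro continuous_intros) (auto simp: less_imp_neq[symmetric] order.strict_implies_not_eq)
  qed (use \<open>T > 0\<close> in auto)
  moreover have "1 / N T > 0" using Npos[of T] \<open>T > 0\<close> by simp
  moreover have "N 0 = - m 0" by (simp add: N_def)
  ultimately have "T < 2 * (1 / - m 0)" by (simp only: diff_0_right)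
  then show ?thesis by simp
qed

lemma derivative_along_curve:
  fixes u :: "real \<Rightarrow> real \<Rightarrow> real"
  assumes "t \<in> S" and d: "(u t has_real_derivative f) (at (y t))"
    and y: "(y has_real_derivative y') (at t within S)"
    and ut: "continuous_on UNIV ut"
    and unif: "\<And>e. e > 0 \<Longrightarrow> \<exists>d>0. \<forall>r\<in>S. r \<noteq> t \<longrightarrow> \<bar>r - t\<bar> < d \<longrightarrow> (\<forall>x. \<bar>(u r x - u t x) / (r - t) - ut x\<bar> \<le> e)"
  shows "((\<lambda>r. u r (y r)) has_real_derivative ut (y t) + f * y') (at t within S)"
  unfolding has_field_derivative_iff
proof -
  have 1: "((\<lambda>r. (u t (y r) - u t (y t)) / (r - t)) \<longlongrightarrow> f * y') (at t within S)"
    using DERIV_chain2[OF d y] by (simp add: has_field_derivative_iff)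
  have "(y \<longlongrightarrow> y t) (at t within S)"
    using y by (simp add: DERIV_continuous continuous_within[symmetric])
  then have 2: "((\<lambda>r. ut (y r)) \<longlongrightarrow> ut (y t)) (at t within S)"
    using ut by (intro isCont_tendsto_compose[where g=ut]) (auto simp: continuous_on_eq_continuous_at)
  have 3: "((\<lambda>r. (u r (y r) - u t (y r)) / (r - t) - ut (y r)) \<longlongrightarrow> 0) (at t within S)"
  proof (rule tendstoI)
    fix e :: real assume "e > 0"
    then obtain d where "d > 0" and
      d: "\<forall>r\<in>S. r \<noteq> t \<longrightarrow> \<bar>r - t\<bar> < d \<longrightarrow> (\<forall>x. \<bar>(u r x - u t x) / (r - t) - ut x\<bar> \<le> e / 2)"
      using unif[OF half_gt_zero] by blast
    have "\<bar>(u r (y r) - u t (y r)) / (r - t) - ut (y r)\<bar> < e"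
      if "r \<in> S" "r \<noteq> t" "\<bar>r - t\<bar> < d" for r
      using d[rule_format, OF that, of "y r"] \<open>e > 0\<close> by linarith
    with \<open>d > 0\<close> show "\<forall>\<^sub>F r in at t within S. dist ((u r (y r) - u t (y r)) / (r - t) - ut (y r)) 0 < e"
      unfolding eventually_at dist_real_def by (intro exI[of _ d]) auto
  qed
  have "((\<lambda>r. ((u r (y r) - u t (y r)) / (r - t) - ut (y r)) + ut (y r) + (u t (y r) - u t (y t)) / (r - t))
      \<longlongrightarrow> 0 + ut (y t) + f * y') (at t within S)"
    by (intro tendsto_add 1 2 3)
  then show "((\<lambda>r. (u r (y r) - u t (y t)) / (r - t)) \<longlongrightarrow> ut (y t) + f * y') (at t within S)"
    by (simp add: diff_divide_distrib)
qed

text \<open>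
  The increment \<open>u t (q t + h) - u t (q t)\<close> over a fixed distance \<open>h\<close> is differentiable in time
  without any second derivative of \<open>u\<close>, which need not exist pointwise for \<open>s\<close> close to \<open>2\<close>.
\<close>

lemma riccati_along_characteristic:
  fixes u ut f :: "real \<Rightarrow> real \<Rightarrow> real"
  assumes "T > 0"
    and du: "\<And>t x. t \<in> {0..T} \<Longrightarrow> (u t has_real_derivative f t x) (at x)"
    and fc: "continuous_on ({0..T} \<times> UNIV) (\<lambda>(t, x). f t x)"
    and fB: "\<And>t x. t \<in> {0..T} \<Longrightarrow> \<bar>f t x\<bar> \<le> B"
    and utc: "\<And>t. t \<in> {0..T} \<Longrightarrow> continuous_on UNIV (ut t)"
    and ut: "\<And>t e. t \<in> {0..T} \<Longrightarrow> e > 0 \<Longrightarrow> \<exists>d>0. \<forall>r\<in>{0..T}. r \<noteq> t \<longrightarrow> \<bar>r - t\<bar> < d \<longrightarrow>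
               (\<forall>x. \<bar>(u r x - u t x) / (r - t) - ut t x\<bar> \<le> e)"
    and P: "\<And>t x y. t \<in> {0..T} \<Longrightarrow> x \<le> y \<Longrightarrow>
               (ut t y + u t y * f t y) - (ut t x + u t x * f t x) \<le> integral {x..y} (\<lambda>z. (f t z)\<^sup>2 / 2)"
    and q: "\<And>t. t \<in> {0..T} \<Longrightarrow> (q has_real_derivative u t (q t)) (at t within {0..T})"
    and t0: "t0 \<in> {0..T}"
  shows "f t0 (q t0) \<le> f 0 (q 0) - integral {0..t0} (\<lambda>t. (f t (q t))\<^sup>2 / 2)"
proof (rule field_le_epsilon)
  fix \<eta> :: real assume \<eta>: "\<eta> > 0"
  define m where "m = (\<lambda>t. f t (q t))"
  have B0: "0 \<le> B" using fB[of 0 0] \<open>T > 0\<close> by force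
  define C where "C = (3 * B + 2) * T + 2"
  have C: "C > 0" using B0 \<open>T > 0\<close> by (simp add: C_def add_nonneg_pos)
  define e where "e = min 1 (\<eta> / C)"
  have e: "0 < e" "e \<le> 1" "e * C \<le> \<eta>"
    using \<eta> C by (auto simp: e_def min_def field_simps)
  have qc: "continuous_on {0..T} q" by (rule DERIV_continuous_on) (rule q)
  have mc: "continuous_on {0..T} m"
  proof -
    have "continuous_on {0..T} (\<lambda>t. (\<lambda>(t, x). f t x) (t, q t))"
      by (rule continuous_on_compose2[OF fc]) (auto intro!: continuous_intros qc)
    then show ?thesis by (simp add: m_def)
  qed
  have "bounded (q ` {0..T})" by (intro compact_imp_bounded compact_continuous_image qc) auto
  then obtain R where "\<forall>x\<in>q ` {0..T}. norm x \<le> R" unfolding bounded_iff by blast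
  then have R: "\<bar>q t\<bar> \<le> R" if "t \<in> {0..T}" for t using that by auto
  have "uniformly_continuous_on ({0..T} \<times> {- R..R + 1}) (\<lambda>(t, x). f t x)"
    by (intro compact_uniformly_continuous continuous_on_subset[OF fc] compact_Times) auto
  then obtain d where d: "d > 0" and d0: "\<forall>p\<in>{0..T} \<times> {- R..R + 1}. \<forall>p'\<in>{0..T} \<times> {- R..R + 1}.
       dist p' p < d \<longrightarrow> dist (case p' of (t, x) \<Rightarrow> f t x) (case p of (t, x) \<Rightarrow> f t x) < e"
    unfolding uniformly_continuous_on_def using e(1) by blast
  have d': "\<bar>f t y - f t x\<bar> < e"
    if "t \<in> {0..T}" "x \<in> {- R..R + 1}" "y \<in> {- R..R + 1}" "\<bar>y - x\<bar> < d" for t x y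
    using d0[rule_format, of "(t, x)" "(t, y)"] that by (auto simp: dist_Pair_Pair dist_real_def)
  define h where "h = min 1 (d / 2)"
  have h: "0 < h" "h \<le> 1" "h < d" using d by (auto simp: h_def min_def)
  have near: "\<bar>f t y - m t\<bar> \<le> e" if "t \<in> {0..T}" "q t \<le> y" "y \<le> q t + h" for t y
    unfolding m_def using R[OF that(1)] that h by (intro less_imp_le d') auto
  define D where "D = (\<lambda>t. (u t (q t + h) - u t (q t)) / h)"
  have Dm: "\<bar>D t - m t\<bar> \<le> e" if t: "t \<in> {0..T}" for t
  proof -
    obtain z where z: "q t < z" "z < q t + h" "u t (q t + h) - u t (q t) = (q t + h - q t) * f t z"
      using MVT2[of "q t" "q t + h" "u t" "f t"] du[OF t] h by (metis less_add_same_cancel1)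
    then have "D t = f t z" using h by (simp add: D_def)
    then show ?thesis using near[OF t, of z] z by simp
  qed
  define D' where "D' = (\<lambda>t. ((ut t (q t + h) + f t (q t + h) * u t (q t)) - (ut t (q t) + f t (q t) * u t (q t))) / h)"
  have DD: "(D has_real_derivative D' t) (at t within {0..T})" if t: "t \<in> {0..T}" for t
  proof -
    have "((\<lambda>r. u r (q r + a)) has_real_derivative ut t (q t + a) + f t (q t + a) * u t (q t)) (at t within {0..T})" for a
      by (rule derivative_along_curve[OF t du[OF t] _ utc[OF t] ut[OF t]]) (auto intro!: derivative_eq_intros q t)
    from this[of h] this[of 0] show ?thesis
      unfolding D_def D'_def by (auto intro!: DERIV_cdivide DERIV_diff)
  qed
  define E where "E = (3 * B + 2) * e"
  have D'_le: "D' t \<le> - (m t)\<^sup>2 / 2 + E" if t: "t \<in> {0..T}" for t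
  proof -
    define a where "a = f t (q t + h) - m t"
    define b where "b = D t - m t"
    have a: "\<bar>a\<bar> \<le> e" unfolding a_def using near[OF t, of "q t + h"] h by auto
    have b: "\<bar>b\<bar> \<le> e" unfolding b_def by (rule Dm[OF t])
    have mB: "\<bar>m t\<bar> \<le> B" unfolding m_def by (rule fB[OF t])
    have "D' t = ((ut t (q t + h) + u t (q t + h) * f t (q t + h)) - (ut t (q t) + u t (q t) * f t (q t))) / h
        - f t (q t + h) * D t"
      using h by (simp add: D'_def D_def field_simps)
    also have "((ut t (q t + h) + u t (q t + h) * f t (q t + h)) - (ut t (q t) + u t (q t) * f t (q t))) / h
        \<le> integral {q t..q t + h} (\<lambda>z. (f t z)\<^sup>2 / 2) / h"
      using h by (intro divide_right_mono P t) auto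
    also have "integral {q t..q t + h} (\<lambda>z. (f t z)\<^sup>2 / 2) \<le> integral {q t..q t + h} (\<lambda>z. (\<bar>m t\<bar> + e)\<^sup>2 / 2)"
    proof (rule integral_le)
      have "continuous_on {q t..q t + h} (\<lambda>z. (\<lambda>(t, x). f t x) (t, z))"
        by (rule continuous_on_compose2[OF fc]) (use t in \<open>auto intro!: continuous_intros\<close>)
      then show "(\<lambda>z. (f t z)\<^sup>2 / 2) integrable_on {q t..q t + h}"
        by (intro integrable_continuous_interval continuous_intros) auto
      fix z assume "z \<in> {q t..q t + h}"
      then have "\<bar>f t z\<bar> \<le> \<bar>m t\<bar> + e" using near[OF t, of z] by auto
      then have "\<bar>f t z\<bar>\<^sup>2 \<le> (\<bar>m t\<bar> + e)\<^sup>2" by (intro power_mono) auto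
      then show "(f t z)\<^sup>2 / 2 \<le> (\<bar>m t\<bar> + e)\<^sup>2 / 2" by simp
    qed auto
    also have "\<dots> / h = (\<bar>m t\<bar> + e)\<^sup>2 / 2" using h by simp
    finally have "D' t \<le> (\<bar>m t\<bar> + e)\<^sup>2 / 2 - (m t + a) * (m t + b)"
      using h by (simp add: a_def b_def divide_right_mono)
    moreover have "(m t + a) * (m t + b) = (m t)\<^sup>2 + m t * (a + b) + a * b"
      by (simp add: power2_eq_square algebra_simps)
    moreover have "\<bar>m t * (a + b)\<bar> \<le> B * (2 * e)"
      unfolding abs_mult using a b by (intro mult_mono mB B0) auto
    moreover have "\<bar>a * b\<bar> \<le> e * 1"
      unfolding abs_mult using a b e by (intro mult_mono) auto
    moreover have "(\<bar>m t\<bar> + e)\<^sup>2 / 2 = (m t)\<^sup>2 / 2 + \<bar>m t\<bar> * e + e * e / 2"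
      by (simp add: power2_eq_square field_simps)
    moreover have "\<bar>m t\<bar> * e \<le> B * e" using mB e by (intro mult_right_mono) auto
    moreover have "e * e \<le> e * 1" using e by (intro mult_left_mono) auto
    moreover have "E = 3 * (B * e) + 2 * e" by (simp add: E_def algebra_simps)
    ultimately show ?thesis using e by linarith
  qed
  define J where "J = (\<lambda>t. integral {0..t} (\<lambda>\<tau>. (m \<tau>)\<^sup>2 / 2))"
  have m2c: "continuous_on {0..T} (\<lambda>\<tau>. (m \<tau>)\<^sup>2 / 2)" by (intro continuous_intros mc) auto
  have J: "(J has_real_derivative (m t)\<^sup>2 / 2) (at t within {0..T})" if "t \<in> {0..T}" for t
    unfolding J_def by (rule integral_has_real_derivative[OF m2c that])
  have "D t0 + J t0 - E * t0 \<le> D 0 + J 0 - E * 0"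
  proof (rule DERIV_nonpos_imp_decreasing_open[of 0 t0 "\<lambda>t. D t + J t - E * t"])
    fix t assume t: "0 < t" "t < t0"
    then have tT: "t \<in> {0..T}" using t0 by auto
    have "at t within {0..T} = at t" using t t0 by (intro at_within_Icc_at) auto
    then have "((\<lambda>t. D t + J t - E * t) has_real_derivative D' t + (m t)\<^sup>2 / 2 - E) (at t)"
      using DD[OF tT] J[OF tT] by (auto intro!: derivative_eq_intros)
    then show "\<exists>y. ((\<lambda>t. D t + J t - E * t) has_real_derivative y) (at t) \<and> y \<le> 0"
      using D'_le[OF tT] by (intro exI[of _ "D' t + (m t)\<^sup>2 / 2 - E"]) auto
  next
    have "continuous_on {0..T} D" "continuous_on {0..T} J"
      by (rule DERIV_continuous_on, erule DD, rule DERIV_continuous_on, erule J)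
    then show "continuous_on {0..t0} (\<lambda>t. D t + J t - E * t)"
      using t0 by (intro continuous_intros) (auto elim: continuous_on_subset)
  qed (use t0 in auto)
  moreover have "J 0 = 0" by (simp add: J_def)
  moreover have "E * t0 \<le> E * T" using t0 B0 e by (intro mult_left_mono) (auto simp: E_def)
  moreover have "E * T + 2 * e = e * C" by (simp add: E_def C_def algebra_simps)
  ultimately have "m t0 \<le> m 0 - J t0 + \<eta>"
    using Dm[OF t0] Dm[of 0] e(3) \<open>T > 0\<close> by (auto simp: abs_le_iff)
  then show "f t0 (q t0) \<le> f 0 (q 0) - integral {0..t0} (\<lambda>t. (f t (q t))\<^sup>2 / 2) + \<eta>"
    by (simp add: m_def J_def)
qed

section \<open>Lifespan of solutions\<close>

lemma E_curve_uniform: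
  assumes s: "s \<ge> 2" and c: "continuous_curve (E_space s) (E_norm s) T u" and t: "t \<in> {0..T}" and "e > 0"
  shows "\<exists>d>0. \<forall>r\<in>{0..T}. \<bar>r - t\<bar> < d \<longrightarrow>
           (\<forall>x. \<bar>u r x - u t x\<bar> \<le> e) \<and> (\<forall>x. \<bar>deriv (u r) x - deriv (u t) x\<bar> \<le> e)"
proof -
  have E: "u r \<in> E_space s" if "r \<in> {0..T}" for r
    using c that by (simp add: continuous_curve_def)
  have "((\<lambda>r. E_norm s (\<lambda>x. u r x - u t x)) \<longlongrightarrow> 0) (at t within {0..T})"
    using c t by (simp add: continuous_curve_def)
  from tendstoD[OF this \<open>e > 0\<close>] obtain d where "d > 0" and
    d: "\<And>r. r \<in> {0..T} \<Longrightarrow> r \<noteq> t \<Longrightarrow> \<bar>r - t\<bar> < d \<Longrightarrow> \<bar>E_norm s (\<lambda>x. u r x - u t x)\<bar> < e"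
    by (auto simp: eventually_at dist_real_def)
  have "\<bar>u r x - u t x\<bar> \<le> e \<and> \<bar>deriv (u r) x - deriv (u t) x\<bar> \<le> e"
    if r: "r \<in> {0..T}" "\<bar>r - t\<bar> < d" for r x
  proof (cases "r = t")
    case False
    then have n: "E_norm s (\<lambda>x. u r x - u t x) < e" using d[OF r(1) False r(2)] by linarith
    have diff: "(\<lambda>x. u r x - u t x) \<in> E_space s" by (intro E_space_diff s E r t)
    have "deriv (\<lambda>x. u r x - u t x) x = deriv (u r) x - deriv (u t) x"
      by (intro DERIV_imp_deriv DERIV_diff E_space_derivative(1)[OF s] E r t)
    then show ?thesis
      using E_norm_controls_C1[OF s diff n, of x] by simp
  qed (use \<open>e > 0\<close> in simp)
  then show ?thesis using \<open>d > 0\<close> by blast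
qed

lemma Ebar_curve_difference_quotient:
  assumes c: "C1_curve (Ebar_space s) (Ebar_norm s) T u ut" and t: "t \<in> {0..T}" and "e > 0"
  shows "\<exists>d>0. \<forall>r\<in>{0..T}. r \<noteq> t \<longrightarrow> \<bar>r - t\<bar> < d \<longrightarrow>
           (\<forall>x. \<bar>(u r x - u t x) / (r - t) - ut t x\<bar> \<le> e)"
proof -
  have b: "bounded (range (u r))" "bounded (range (ut r))" if "r \<in> {0..T}" for r
    using c that by (auto simp: C1_curve_def continuous_curve_def Ebar_space_def)
  have "((\<lambda>r. Ebar_norm s (\<lambda>x. (u r x - u t x) / (r - t) - ut t x)) \<longlongrightarrow> 0) (at t within {0..T})"
    using c t by (simp add: C1_curve_def)
  from tendstoD[OF this \<open>e > 0\<close>] obtain d where "d > 0" and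
    d: "\<And>r. r \<in> {0..T} \<Longrightarrow> r \<noteq> t \<Longrightarrow> \<bar>r - t\<bar> < d \<Longrightarrow>
          \<bar>Ebar_norm s (\<lambda>x. (u r x - u t x) / (r - t) - ut t x)\<bar> < e"
    by (auto simp: eventually_at dist_real_def)
  have "\<bar>(u r x - u t x) / (r - t) - ut t x\<bar> \<le> e" if r: "r \<in> {0..T}" "r \<noteq> t" "\<bar>r - t\<bar> < d" for r x
  proof -
    let ?w = "\<lambda>x. (u r x - u t x) / (r - t) - ut t x"
    have "bounded (range (\<lambda>x. inverse (r - t) *\<^sub>R (u r x - u t x)))"
      using b[OF r(1)] b[OF t] by (intro bounded_scaleR_comp bounded_minus_comp) auto
    then have "bounded (range (\<lambda>x. inverse (r - t) *\<^sub>R (u r x - u t x) - ut t x))"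
      using b[OF t] by (intro bounded_minus_comp) auto
    then have w: "bounded (range ?w)" by (simp add: divide_inverse mult.commute)
    have "\<bar>?w x\<bar> \<le> sup_norm ?w" by (rule abs_le_sup_norm[OF w])
    also have "\<dots> \<le> Ebar_norm s ?w"
      unfolding Ebar_norm_def by (simp add: weighted_norm_nonneg)
    also have "\<dots> < e" using d[OF r] by linarith
    finally show ?thesis by simp
  qed
  then show ?thesis using \<open>d > 0\<close> by blast
qed

text \<open>
  No integrability is required: if \<open>h\<close> is not integrable on \<open>{..y}\<close>, the first integral has the
  junk value \<open>0\<close>. This is why square integrability of \<open>u\<^sub>x\<close> never has to be derived.
\<close>

lemma set_lebesgue_integral_atMost_diff_le:
  fixes h :: "real \<Rightarrow> real"
  assumes h: "continuous_on UNIV h" "\<And>x. 0 \<le> h x" and "x \<le> y"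
  shows "(LINT z:{..y}|lborel. h z) - (LINT z:{..x}|lborel. h z) \<le> integral {x..y} h"
proof -
  have i: "set_integrable lborel {x..y} h"
    by (intro borel_integrable_atLeastAtMost' continuous_on_subset[OF h(1)]) auto
  have eq: "integral {x..y} h = (LINT z:{x..y}|lborel. h z)"
    using set_borel_integral_eq_integral(2)[OF i] by simp
  have nn: "0 \<le> (LINT z:A|lborel. h z)" for A
    unfolding set_lebesgue_integral_def by (intro integral_nonneg_AE) (auto simp: h)
  show ?thesis
  proof (cases "set_integrable lborel {..y} h")
    case True
    have ix: "set_integrable lborel {..x} h" and ixy: "set_integrable lborel {x<..y} h"
      using \<open>x \<le> y\<close> by (auto intro: set_integrable_subset[OF True])
    have "{..y} = {..x} \<union> {x<..y}" using \<open>x \<le> y\<close> by auto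
    then have "(LINT z:{..y}|lborel. h z) = (LINT z:{..x}|lborel. h z) + (LINT z:{x<..y}|lborel. h z)"
      by (simp only:) (intro set_integral_Un ix ixy, auto)
    moreover have "(LINT z:{x<..y}|lborel. h z) \<le> (LINT z:{x..y}|lborel. h z)"
      unfolding set_lebesgue_integral_def
      using i ixy by (intro integral_mono) (auto simp: set_integrable_def h indicator_def)
    ultimately show ?thesis using eq by simp
  next
    case False
    then have "(LINT z:{..y}|lborel. h z) = 0"
      by (simp add: set_integrable_def set_lebesgue_integral_def not_integrable_integral_eq)
    then show ?thesis using nn[of "{..x}"] nn[of "{x..y}"] eq by simp
  qed
qed

lemma solution_lifespan:
  assumes s: "s \<ge> 2" and "T > 0" and sol: "is_solution s g u0 T u" and neg: "deriv u0 x0 < 0"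
  shows "T < 2 / - deriv u0 x0"
proof -
  obtain ut where c: "continuous_curve (E_space s) (E_norm s) T u"
    and C1: "C1_curve (Ebar_space s) (Ebar_norm s) T u ut"
    and pde: "\<And>t x. t \<in> {0..T} \<Longrightarrow> ut t x + u t x * deriv (u t) x
            = (LINT z:{..x}|lborel. 1 / 2 * (deriv (u t) z)\<^sup>2) + g t"
    and u0: "u 0 = u0"
    using sol by (auto simp: is_solution_def)
  have E: "u t \<in> E_space s" if "t \<in> {0..T}" for t
    using c that by (simp add: continuous_curve_def)
  have u: "continuous_on UNIV (u t)" if "t \<in> {0..T}" for t
    using E[OF that] by (simp add: E_space_def)
  have du: "(u t has_real_derivative deriv (u t) x) (at x)" if "t \<in> {0..T}" for t x
    by (rule E_space_derivative[OF s E[OF that]])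
  have f: "continuous_on UNIV (deriv (u t))" "bounded (range (deriv (u t)))" if "t \<in> {0..T}" for t
    by (rule E_space_derivative[OF s E[OF that]])+
  have u_unif: "\<exists>d>0. \<forall>r\<in>{0..T}. \<bar>r - t\<bar> < d \<longrightarrow> (\<forall>x. \<bar>u r x - u t x\<bar> \<le> e)"
    and f_unif: "\<exists>d>0. \<forall>r\<in>{0..T}. \<bar>r - t\<bar> < d \<longrightarrow> (\<forall>x. \<bar>deriv (u r) x - deriv (u t) x\<bar> \<le> e)"
    if "t \<in> {0..T}" "e > 0" for t e
    using E_curve_uniform[OF s c that] by blast+
  have uc: "continuous_on ({0..T} \<times> UNIV) (\<lambda>(t, x). u t x)"
    by (rule uniform_family_continuous[OF u u_unif])
  have fc: "continuous_on ({0..T} \<times> UNIV) (\<lambda>(t, x). deriv (u t) x)"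
    by (rule uniform_family_continuous[OF f(1) f_unif])
  obtain B where "B > 0" and B: "\<And>t x. t \<in> {0..T} \<Longrightarrow> \<bar>deriv (u t) x\<bar> \<le> B"
    using uniform_family_bounded[of "{0..T}" "\<lambda>t. deriv (u t)"] f f_unif by blast
  have lip: "\<bar>u t x - u t y\<bar> \<le> B * \<bar>x - y\<bar>" if "t \<in> {0..T}" for t x y
    using field_differentiable_bound[of UNIV "u t" "deriv (u t)" B x y] du[OF that] B[OF that] by simp
  obtain q where q0: "q 0 = x0"
    and q: "\<And>t. t \<in> {0..T} \<Longrightarrow> (q has_real_derivative u t (q t)) (at t within {0..T})"
    using picard_lindelof_global[OF less_imp_le[OF \<open>T > 0\<close>] \<open>B > 0\<close> uc lip] by blast
  define m where "m = (\<lambda>t. deriv (u t) (q t))"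
  have "continuous_on {0..T} q" by (rule DERIV_continuous_on) (rule q)
  then have "continuous_on {0..T} (\<lambda>t. (\<lambda>(t, x). deriv (u t) x) (t, q t))"
    by (intro continuous_on_compose2[OF fc] continuous_intros) auto
  then have mc: "continuous_on {0..T} m" by (simp add: m_def)
  have utc: "continuous_on UNIV (ut t)" if "t \<in> {0..T}" for t
    using C1 that by (simp add: C1_curve_def continuous_curve_def Ebar_space_def)
  have P: "(ut t y + u t y * deriv (u t) y) - (ut t x + u t x * deriv (u t) x)
      \<le> integral {x..y} (\<lambda>z. (deriv (u t) z)\<^sup>2 / 2)" if t: "t \<in> {0..T}" and "x \<le> y" for t x y
    using set_lebesgue_integral_atMost_diff_le[of "\<lambda>z. (deriv (u t) z)\<^sup>2 / 2" x y] f(1)[OF t] \<open>x \<le> y\<close>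
    by (simp add: pde[OF t] continuous_intros)
  have "m t \<le> m 0 - integral {0..t} (\<lambda>\<tau>. (m \<tau>)\<^sup>2 / 2)" if "t \<in> {0..T}" for t
    unfolding m_def
    by (rule riccati_along_characteristic[OF \<open>T > 0\<close> du fc B utc Ebar_curve_difference_quotient[OF C1] P q that])
  moreover have m0: "m 0 = deriv u0 x0" by (simp add: m_def q0 u0)
  ultimately show ?thesis
    using riccati_lifespan[OF \<open>T > 0\<close> mc] neg by simp
qed

theorem theorem4p6:
  fixes g u0 :: "real \<Rightarrow> real" and s x0 :: real
  assumes "bounded (g ` {0..})"
    and "s \<ge> 2"
    and "u0 \<in> E_space s"
    and "deriv u0 x0 < 0"
  shows "blows_up_in_finite_time s g u0"
proof -
  have "max_existence_time s g u0 \<le> ereal (2 / - deriv u0 x0)"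
    unfolding max_existence_time_def
    using solution_lifespan[OF assms(2) _ _ assms(4)] by (intro Sup_least) (auto simp: less_imp_le)
  then show ?thesis
    unfolding blows_up_in_finite_time_def using le_less_trans by fastforce
qed

end
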